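(* Let $F:T^{1,0}M\to[0,+\infty)$ be a strongly convex Kähler-Berwald metric on a complex manifold $M$, with associated Cartan connection $\nabla$, and let $\mathbf J$ be the canonical complex structure on the complex manifold $T^{1,0}M$. Then $\nabla_X\mathbf J=0$ for all $X\in\mathcal H_{\mathbb R}$.
   Context: Standing conventions. $M$ is a complex manifold of complex dimension $n\ge 2$ with canonical complex structure $J$ on the real tangent bundle $T_{\mathbb R}M$. Greek indices run over $1,\dots,n$, Latin indices over $1,\dots,2n$, $\alpha^*=\alpha+n$, and repeated indices are summed. Local holomorphic coordinates are $z^\alpha=x^\alpha+ix^{\alpha^*}$, with fiber coordinates $v=v^\alpha\frac{\partial}{\partial z^\alpha}\in T^{1,0}M$, $v^\alpha=y^\alpha+iy^{\alpha^*}$. $T_{\mathbb R}M$ and $T^{1,0}M$ are identified by $y=y^j\frac{\partial}{\partial x^j}\mapsto y_o=\frac12(y-iJy)=v$. $\tilde M$ denotes $T^{1,0}M\setminus\{0\}\cong T_{\mathbb R}M\setminus\{0\}$; $\mathbf J\frac{\partial}{\partial x^\alpha}=\frac{\partial}{\partial x^{\alpha^*}}$, $\mathbf J\frac{\partial}{\partial x^{\alpha^*}}=-\frac{\partial}{\partial x^\alpha}$, $\mathbf J\frac{\partial}{\partial y^\alpha}=\frac{\partial}{\partial y^{\alpha^*}}$, $\mathbf J\frac{\partial}{\partial y^{\alpha^*}}=-\frac{\partial}{\partial y^\alpha}$. A strongly convex complex Finsler metric is a function $F:T^{1,0}M\to[0,+\infty)$, positive and $C^\infty$ on $\tilde M$,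 with $F(z;\lambda v)=|\lambda|F(z;v)$ for $\lambda\in\mathbb C$, such that, viewing $F$ as a function of $(x;y)$, the matrix $g_{jk}=\frac12\frac{\partial^2F^2}{\partial y^j\partial y^k}$ is positive definite on $\tilde M$ (then $G_{\alpha\bar\beta}=\frac{\partial^2F^2}{\partial v^\alpha\partial\bar v^\beta}$ is Hermitian positive definite). Cartan connection. $\hat{\mathbb G}^k=\frac14g^{kl}\big(\frac{\partial^2F^2}{\partial x^a\partial y^l}y^a-\frac{\partial F^2}{\partial x^l}\big)$, $\hat\Gamma^k_j=\frac{\partial\hat{\mathbb G}^k}{\partial y^j}$, $\frac{\delta}{\delta x^j}=\frac{\partial}{\partial x^j}-\hat\Gamma^k_j\frac{\partial}{\partial y^k}$; $\mathcal H_{\mathbb R}=\mathrm{span}\{\frac{\delta}{\delta x^j}\}$, $\mathcal V_{\mathbb R}=\mathrm{span}\{\frac{\partial}{\partial y^j}\}$. With $\hat\Gamma^k_{j;l}=\frac{g^{ks}}2\big(\frac{\delta g_{sj}}{\delta x^l}-\frac{\delta g_{jl}}{\delta x^s}+\frac{\delta g_{ls}}{\delta x^j}\big)$ and $\hat\Gamma^k_{jl}=\frac14g^{ks}\frac{\partial^3F^2}{\partial y^j\partial y^l\partial y^s}$, the Cartan connection $\nabla$ is the linear connection on $\mathcal V_{\mathbb R}\to\tilde M$ with $\nabla_{\frac{\delta}{\delta x^l}}\frac{\partial}{\partial y^j}=\hat\Gamma^k_{j;l}\frac{\partial}{\partial y^k}$, $\nabla_{\frac{\partial}{\partial y^l}}\frac{\partial}{\partial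 y^j}=\hat\Gamma^k_{jl}\frac{\partial}{\partial y^k}$. $\nabla_X\mathbf J=0$ means $\nabla_X(\mathbf JY)=\mathbf J(\nabla_XY)$ for all sections $Y$ of $\mathcal V_{\mathbb R}$. Kähler-Berwald. With $G^{\bar\tau\alpha}G_{\beta\bar\tau}=\delta^\alpha_\beta$, set $\Gamma^\alpha_{;\mu}=G^{\bar\tau\alpha}\frac{\partial^2F^2}{\partial z^\mu\partial\bar v^\tau}$, $\delta_\mu=\frac{\partial}{\partial z^\mu}-\Gamma^\alpha_{;\mu}\frac{\partial}{\partial v^\alpha}$, $\Gamma^\alpha_{\beta;\mu}=G^{\bar\tau\alpha}\delta_\mu(G_{\beta\bar\tau})$. $F$ is Kähler-Finsler if $\Gamma^\alpha_{\beta;\mu}=\Gamma^\alpha_{\mu;\beta}$; complex Berwald if each $\Gamma^\alpha_{\beta;\mu}$ depends only on the base point $z$; Kähler-Berwald if it is both. *)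

theory Defs
  imports "HOL-Analysis.Analysis"
begin

section \<open>Smooth and holomorphic maps\<close>

primrec diff_class_on ::
  "nat \<Rightarrow> 'a::real_normed_vector set \<Rightarrow> ('a \<Rightarrow> 'b::real_normed_vector) \<Rightarrow> bool" where
  "diff_class_on 0 S f \<longleftrightarrow> continuous_on S f"
| "diff_class_on (Suc k) S f \<longleftrightarrow> (\<forall>x\<in>S. f differentiable (at x)) \<and>
     (\<forall>v. diff_class_on k S (\<lambda>x. frechet_derivative f (at x) v))"

text \<open>\<open>C\<^sup>\<infinity>\<close> on an open set: all iterated directional derivatives exist and are continuous.\<close>

definition smooth_on :: "'a::real_normed_vector set \<Rightarrow> ('a \<Rightarrow> 'b::real_normed_vector) \<Rightarrow> bool" where
  "smooth_on S f \<longleftrightarrow> (\<forall>k. diff_class_on k S f)"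

definition holomorphic_map_on ::
  "(complex^'n) set \<Rightarrow> (complex^'n \<Rightarrow> complex^'n) \<Rightarrow> bool" where
  "holomorphic_map_on S f \<longleftrightarrow>
     (\<forall>z\<in>S. \<exists>D. (f has_derivative D) (at z) \<and> (\<forall>t h. D (t *s h) = t *s D h))"

section \<open>Complex manifolds\<close>

text \<open>The manifold is the whole of a Hausdorff, second countable topological type \<open>'m\<close>, with a
  (not necessarily maximal) holomorphic atlas; its complex dimension is \<open>CARD('n)\<close>.\<close>

type_synonym ('m, 'n) chart = "'m set \<times> ('m \<Rightarrow> complex^'n)"

definition transition :: "('m, 'n) chart \<Rightarrow> ('m, 'n) chart \<Rightarrow> complex^'n \<Rightarrow> complex^'n" where
  "transition c d = snd d \<circ> inv_into (fst c) (snd c)"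

definition complex_manifold ::
  "('m::{t2_space, second_countable_topology}, 'n::finite) chart set \<Rightarrow> bool" where
  "complex_manifold A \<longleftrightarrow>
     (\<Union>c\<in>A. fst c) = UNIV \<and>
     (\<forall>c\<in>A. open (fst c) \<and> open (snd c ` fst c) \<and>
        homeomorphism (fst c) (snd c ` fst c) (snd c) (inv_into (fst c) (snd c))) \<and>
     (\<forall>c\<in>A. \<forall>d\<in>A. holomorphic_map_on (snd c ` (fst c \<inter> fst d)) (transition c d))"

section \<open>The holomorphic tangent bundle\<close>

text \<open>A vector \<open>v\<close> in \<open>T\<^sup>1\<^sup>,\<^sup>0\<^sub>pM\<close> is the family of its component vectors \<open>(v\<^sup>\<alpha>)\<close> in all charts around \<open>p\<close>,
  related by the complex Jacobians of the transition maps; outside the charts around \<open>p\<close> the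
  family has the dummy value \<open>0\<close>.\<close>

type_synonym ('m, 'n) holvec = "('m, 'n) chart \<Rightarrow> complex^'n"
type_synonym ('m, 'n) hpoint = "'m \<times> ('m, 'n) holvec"

definition hol_tangent_space :: "('m, 'n::finite) chart set \<Rightarrow> 'm \<Rightarrow> ('m, 'n) holvec set" where
  "hol_tangent_space A p =
     {v. (\<forall>c\<in>A. \<forall>d\<in>A. p \<in> fst c \<longrightarrow> p \<in> fst d \<longrightarrow>
            v d = frechet_derivative (transition c d) (at (snd c p)) (v c)) \<and>
         (\<forall>c. \<not> (c \<in> A \<and> p \<in> fst c) \<longrightarrow> v c = 0)}"

definition hol_bundle :: "('m, 'n::finite) chart set \<Rightarrow> ('m, 'n) hpoint set" where
  "hol_bundle A = {u. snd u \<in> hol_tangent_space A (fst u)}"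

definition slit_bundle :: "('m, 'n::finite) chart set \<Rightarrow> ('m, 'n) hpoint set" where
  "slit_bundle A = {u \<in> hol_bundle A. snd u \<noteq> (\<lambda>_. 0)}"

section \<open>Induced coordinates on the holomorphic tangent bundle\<close>

text \<open>The Latin indices \<open>1,\<dots>,2n\<close> are the elements of \<open>'n + 'n\<close>: \<open>Inl \<alpha>\<close> is \<open>\<alpha>\<close> and \<open>Inr \<alpha>\<close> is
  \<open>\<alpha>\<^sup>* = \<alpha> + n\<close>.  A chart with coordinates \<open>z\<^sup>\<alpha> = x\<^sup>\<alpha> + \<i> x\<^sup>\<alpha>\<^sup>*\<close> and fibre coordinates
  \<open>v\<^sup>\<alpha> = y\<^sup>\<alpha> + \<i> y\<^sup>\<alpha>\<^sup>*\<close> yields the real coordinates \<open>(x, y)\<close>.  Since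
  \<open>v\<^sup>\<alpha> \<partial>/\<partial>z\<^sup>\<alpha> = (y - \<i> J y) / 2\<close> for \<open>y = y\<^sup>j \<partial>/\<partial>x\<^sup>j\<close>, this is the usual identification of \<open>T\<^sup>1\<^sup>,\<^sup>0M\<close> with
  the real tangent bundle.\<close>

type_synonym 'n rcoord = "real^('n + 'n)"

definition realify :: "complex^'n \<Rightarrow> 'n::finite rcoord" where
  "realify z = (\<chi> j. case j of Inl \<alpha> \<Rightarrow> Re (z $ \<alpha>) | Inr \<alpha> \<Rightarrow> Im (z $ \<alpha>))"

definition bundle_over :: "('m, 'n::finite) chart set \<Rightarrow> ('m, 'n) chart \<Rightarrow> ('m, 'n) hpoint set" where
  "bundle_over A c = {u \<in> hol_bundle A. fst u \<in> fst c}"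

definition coords :: "('m, 'n::finite) chart \<Rightarrow> ('m, 'n) hpoint \<Rightarrow> 'n rcoord \<times> 'n rcoord" where
  "coords c u = (realify (snd c (fst u)), realify (snd u c))"

definition param ::
  "('m, 'n::finite) chart set \<Rightarrow> ('m, 'n) chart \<Rightarrow> 'n rcoord \<times> 'n rcoord \<Rightarrow> ('m, 'n) hpoint" where
  "param A c = inv_into (bundle_over A c) (coords c)"

definition slit_domain ::
  "('m, 'n::finite) chart set \<Rightarrow> ('m, 'n) chart \<Rightarrow> ('n rcoord \<times> 'n rcoord) set" where
  "slit_domain A c = coords c ` (slit_bundle A \<inter> bundle_over A c)"

definition open_in_bundle :: "('m, 'n::finite) chart set \<Rightarrow> ('m, 'n) hpoint set \<Rightarrow> bool" where
  "open_in_bundle A W \<longleftrightarrow>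
     W \<subseteq> hol_bundle A \<and> (\<forall>c\<in>A. open (coords c ` (W \<inter> bundle_over A c)))"

section \<open>Coordinate derivatives\<close>

definition dx :: "'n + 'n \<Rightarrow> ('n::finite rcoord \<times> 'n rcoord \<Rightarrow> 'a::real_normed_vector)
    \<Rightarrow> 'n rcoord \<times> 'n rcoord \<Rightarrow> 'a" where
  "dx j f w = frechet_derivative f (at w) (axis j 1, 0)"

definition dy :: "'n + 'n \<Rightarrow> ('n::finite rcoord \<times> 'n rcoord \<Rightarrow> 'a::real_normed_vector)
    \<Rightarrow> 'n rcoord \<times> 'n rcoord \<Rightarrow> 'a" where
  "dy j f w = frechet_derivative f (at w) (0, axis j 1)"

type_synonym 'n cfun = "'n rcoord \<times> 'n rcoord \<Rightarrow> complex"
type_synonym 'n rfun = "'n rcoord \<times> 'n rcoord \<Rightarrow> real"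

text \<open>\<open>\<partial>/\<partial>z\<^sup>\<alpha>\<close>, \<open>\<partial>/\<partial>v\<^sup>\<alpha>\<close> and the conjugate of the latter.\<close>

definition dz :: "'n::finite \<Rightarrow> 'n cfun \<Rightarrow> 'n cfun" where
  "dz \<alpha> f w = (dx (Inl \<alpha>) f w - \<i> * dx (Inr \<alpha>) f w) / 2"

definition dv :: "'n::finite \<Rightarrow> 'n cfun \<Rightarrow> 'n cfun" where
  "dv \<alpha> f w = (dy (Inl \<alpha>) f w - \<i> * dy (Inr \<alpha>) f w) / 2"

definition dvbar :: "'n::finite \<Rightarrow> 'n cfun \<Rightarrow> 'n cfun" where
  "dvbar \<alpha> f w = (dy (Inl \<alpha>) f w + \<i> * dy (Inr \<alpha>) f w) / 2"

section \<open>Local formulas of real Finsler geometry\<close>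

text \<open>Throughout, \<open>L\<close> is \<open>F\<^sup>2\<close> expressed in the coordinates \<open>(x, y)\<close>.\<close>

definition g_mat :: "'n::finite rfun \<Rightarrow> 'n rcoord \<times> 'n rcoord \<Rightarrow> real^('n + 'n)^('n + 'n)" where
  "g_mat L w = (\<chi> j k. dy j (dy k L) w / 2)"

definition g_inv :: "'n::finite rfun \<Rightarrow> 'n rcoord \<times> 'n rcoord \<Rightarrow> real^('n + 'n)^('n + 'n)" where
  "g_inv L w = matrix_inv (g_mat L w)"

definition spray :: "'n::finite rfun \<Rightarrow> 'n + 'n \<Rightarrow> 'n rfun" where
  "spray L k w =
     (\<Sum>l\<in>UNIV. g_inv L w $ k $ l * ((\<Sum>a\<in>UNIV. dx a (dy l L) w * snd w $ a) - dx l L w)) / 4"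

text \<open>\<open>nonlin L k j\<close> is \<open>\<Gamma>\<^sup>k\<^sub>j\<close>, and \<open>delta L j\<close> is the operator \<open>\<delta>/\<delta>x\<^sup>j\<close>.\<close>

definition nonlin :: "'n::finite rfun \<Rightarrow> 'n + 'n \<Rightarrow> 'n + 'n \<Rightarrow> 'n rfun" where
  "nonlin L k j = dy j (spray L k)"

definition delta :: "'n::finite rfun \<Rightarrow> 'n + 'n \<Rightarrow> 'n rfun \<Rightarrow> 'n rfun" where
  "delta L j f w = dx j f w - (\<Sum>k\<in>UNIV. nonlin L k j w * dy k f w)"

text \<open>\<open>cartan_h L k j l\<close> is \<open>\<Gamma>\<^sup>k\<^sub>j\<^sub>;\<^sub>l\<close> and \<open>cartan_v L k j l\<close> is \<open>\<Gamma>\<^sup>k\<^sub>j\<^sub>l\<close>.\<close>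

definition cartan_h :: "'n::finite rfun \<Rightarrow> 'n + 'n \<Rightarrow> 'n + 'n \<Rightarrow> 'n + 'n \<Rightarrow> 'n rfun" where
  "cartan_h L k j l w =
     (\<Sum>s\<in>UNIV. g_inv L w $ k $ s / 2 *
        (delta L l (\<lambda>w'. g_mat L w' $ s $ j) w
         - delta L s (\<lambda>w'. g_mat L w' $ j $ l) w
         + delta L j (\<lambda>w'. g_mat L w' $ l $ s) w))"

definition cartan_v :: "'n::finite rfun \<Rightarrow> 'n + 'n \<Rightarrow> 'n + 'n \<Rightarrow> 'n + 'n \<Rightarrow> 'n rfun" where
  "cartan_v L k j l w = (\<Sum>s\<in>UNIV. g_inv L w $ k $ s * dy j (dy l (dy s L)) w) / 4"

section \<open>Local formulas of complex Finsler geometry\<close>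

definition G_mat :: "'n::finite rfun \<Rightarrow> 'n rcoord \<times> 'n rcoord \<Rightarrow> complex^'n^'n" where
  "G_mat L w = (\<chi> \<alpha> \<beta>. dv \<alpha> (dvbar \<beta> (\<lambda>w'. of_real (L w'))) w)"

text \<open>The row index is the conjugate one: \<open>G_inv L w $ \<tau> $ \<alpha>\<close> is the inverse component with upper
  indices \<open>\<tau>\<close> (barred) and \<open>\<alpha>\<close>.\<close>

definition G_inv :: "'n::finite rfun \<Rightarrow> 'n rcoord \<times> 'n rcoord \<Rightarrow> complex^'n^'n" where
  "G_inv L w = matrix_inv (G_mat L w)"

text \<open>\<open>c_nonlin L \<alpha> \<mu>\<close> is \<open>\<Gamma>\<^sup>\<alpha>\<^sub>;\<^sub>\<mu>\<close>, \<open>c_delta L \<mu>\<close> is \<open>\<delta>\<^sub>\<mu>\<close> and \<open>c_conn L \<alpha> \<beta> \<mu>\<close> is \<open>\<Gamma>\<^sup>\<alpha>\<^sub>\<beta>\<^sub>;\<^sub>\<mu>\<close>.\<close>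

definition c_nonlin :: "'n::finite rfun \<Rightarrow> 'n \<Rightarrow> 'n \<Rightarrow> 'n cfun" where
  "c_nonlin L \<alpha> \<mu> w =
     (\<Sum>\<tau>\<in>UNIV. G_inv L w $ \<tau> $ \<alpha> * dz \<mu> (dvbar \<tau> (\<lambda>w'. of_real (L w'))) w)"

definition c_delta :: "'n::finite rfun \<Rightarrow> 'n \<Rightarrow> 'n cfun \<Rightarrow> 'n cfun" where
  "c_delta L \<mu> f w = dz \<mu> f w - (\<Sum>\<alpha>\<in>UNIV. c_nonlin L \<alpha> \<mu> w * dv \<alpha> f w)"

definition c_conn :: "'n::finite rfun \<Rightarrow> 'n \<Rightarrow> 'n \<Rightarrow> 'n \<Rightarrow> 'n cfun" where
  "c_conn L \<alpha> \<beta> \<mu> w =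
     (\<Sum>\<tau>\<in>UNIV. G_inv L w $ \<tau> $ \<alpha> * c_delta L \<mu> (\<lambda>w'. G_mat L w' $ \<beta> $ \<tau>) w)"

section \<open>Finsler metrics\<close>

definition F_loc :: "('m, 'n::finite) chart set \<Rightarrow> (('m, 'n) hpoint \<Rightarrow> real) \<Rightarrow> ('m, 'n) chart
    \<Rightarrow> 'n rfun" where
  "F_loc A F c w = F (param A c w)"

definition F2_loc :: "('m, 'n::finite) chart set \<Rightarrow> (('m, 'n) hpoint \<Rightarrow> real) \<Rightarrow> ('m, 'n) chart
    \<Rightarrow> 'n rfun" where
  "F2_loc A F c w = (F_loc A F c w)\<^sup>2"

definition pos_definite :: "real^'k^'k \<Rightarrow> bool" where
  "pos_definite B \<longleftrightarrow> transpose B = B \<and> (\<forall>\<xi>. \<xi> \<noteq> 0 \<longrightarrow> \<xi> \<bullet> (B *v \<xi>) > 0)"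

definition strongly_convex_finsler ::
  "('m, 'n::finite) chart set \<Rightarrow> (('m, 'n) hpoint \<Rightarrow> real) \<Rightarrow> bool" where
  "strongly_convex_finsler A F \<longleftrightarrow>
     (\<forall>u\<in>hol_bundle A. F u \<ge> 0) \<and>
     (\<forall>u\<in>slit_bundle A. F u > 0) \<and>
     (\<forall>c\<in>A. smooth_on (slit_domain A c) (F_loc A F c)) \<and>
     (\<forall>(p, v)\<in>hol_bundle A. \<forall>t. F (p, \<lambda>c. t *s v c) = cmod t * F (p, v)) \<and>
     (\<forall>c\<in>A. \<forall>w\<in>slit_domain A c. pos_definite (g_mat (F2_loc A F c) w))"

definition kaehler_finsler ::
  "('m, 'n::finite) chart set \<Rightarrow> (('m, 'n) hpoint \<Rightarrow> real) \<Rightarrow> bool" where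
  "kaehler_finsler A F \<longleftrightarrow>
     (\<forall>c\<in>A. \<forall>w\<in>slit_domain A c. \<forall>\<alpha> \<beta> \<mu>.
        c_conn (F2_loc A F c) \<alpha> \<beta> \<mu> w = c_conn (F2_loc A F c) \<alpha> \<mu> \<beta> w)"

definition complex_berwald ::
  "('m, 'n::finite) chart set \<Rightarrow> (('m, 'n) hpoint \<Rightarrow> real) \<Rightarrow> bool" where
  "complex_berwald A F \<longleftrightarrow>
     (\<forall>c\<in>A. \<forall>x y y'. (x, y) \<in> slit_domain A c \<longrightarrow> (x, y') \<in> slit_domain A c \<longrightarrow>
        (\<forall>\<alpha> \<beta> \<mu>. c_conn (F2_loc A F c) \<alpha> \<beta> \<mu> (x, y) = c_conn (F2_loc A F c) \<alpha> \<beta> \<mu> (x, y')))"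

definition kaehler_berwald ::
  "('m, 'n::finite) chart set \<Rightarrow> (('m, 'n) hpoint \<Rightarrow> real) \<Rightarrow> bool" where
  "kaehler_berwald A F \<longleftrightarrow> kaehler_finsler A F \<and> complex_berwald A F"

section \<open>Real tangent vectors of the bundle; horizontal and vertical subbundles\<close>

text \<open>A real tangent vector of \<open>T\<^sup>1\<^sup>,\<^sup>0M\<close> at \<open>u\<close> is again a family, indexed by the charts around the base
  point of \<open>u\<close>: the pair \<open>(a, b)\<close> stands for \<open>a\<^sup>j \<partial>/\<partial>x\<^sup>j + b\<^sup>j \<partial>/\<partial>y\<^sup>j\<close> in the induced coordinates.\<close>

type_synonym ('m, 'n) rvec = "('m, 'n) chart \<Rightarrow> 'n rcoord \<times> 'n rcoord"

definition real_tangent_space ::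
  "('m, 'n::finite) chart set \<Rightarrow> ('m, 'n) hpoint \<Rightarrow> ('m, 'n) rvec set" where
  "real_tangent_space A u =
     {X. (\<forall>c\<in>A. \<forall>d\<in>A. fst u \<in> fst c \<longrightarrow> fst u \<in> fst d \<longrightarrow>
            X d = frechet_derivative (coords d \<circ> param A c) (at (coords c u)) (X c)) \<and>
         (\<forall>c. \<not> (c \<in> A \<and> fst u \<in> fst c) \<longrightarrow> X c = 0)}"

definition horizontal :: "('m, 'n::finite) chart set \<Rightarrow> (('m, 'n) hpoint \<Rightarrow> real) \<Rightarrow> ('m, 'n) hpoint
    \<Rightarrow> ('m, 'n) rvec set" where
  "horizontal A F u =
     {X \<in> real_tangent_space A u. \<forall>c\<in>A. fst u \<in> fst c \<longrightarrow>
        X c \<in> span (range (\<lambda>j. (axis j 1,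
                 - (\<Sum>k\<in>UNIV. nonlin (F2_loc A F c) k j (coords c u) *\<^sub>R axis k 1))))}"

definition vertical ::
  "('m, 'n::finite) chart set \<Rightarrow> ('m, 'n) hpoint \<Rightarrow> ('m, 'n) rvec set" where
  "vertical A u =
     {X \<in> real_tangent_space A u. \<forall>c\<in>A. fst u \<in> fst c \<longrightarrow>
        X c \<in> span (range (\<lambda>j. (0, axis j 1)))}"

definition J_coord :: "'n::finite rcoord \<Rightarrow> 'n rcoord" where
  "J_coord a = (\<chi> j. case j of Inl \<alpha> \<Rightarrow> - a $ Inr \<alpha> | Inr \<alpha> \<Rightarrow> a $ Inl \<alpha>)"

definition J_vec :: "('m, 'n::finite) rvec \<Rightarrow> ('m, 'n) rvec" where
  "J_vec X = (\<lambda>c. (J_coord (fst (X c)), J_coord (snd (X c))))"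

lemma J_coord_axis:
  "J_coord (axis (Inl \<alpha>) 1) = axis (Inr \<alpha>) 1"
  "J_coord (axis (Inr \<alpha>) 1) = - axis (Inl \<alpha>) 1"
  by (auto simp: J_coord_def axis_def vec_eq_iff split: sum.splits)

definition vertical_section :: "('m, 'n::finite) chart set \<Rightarrow> ('m, 'n) hpoint set
    \<Rightarrow> (('m, 'n) hpoint \<Rightarrow> ('m, 'n) rvec) \<Rightarrow> bool" where
  "vertical_section A W Y \<longleftrightarrow>
     (\<forall>u\<in>W. Y u \<in> vertical A u) \<and>
     (\<forall>c\<in>A. smooth_on (coords c ` (W \<inter> bundle_over A c)) (\<lambda>w. Y (param A c w) c))"

section \<open>The Cartan connection\<close>

text \<open>In a chart, \<open>X = (a, b)\<close> is \<open>a\<^sup>l \<delta>/\<delta>x\<^sup>l + (b\<^sup>l + \<Gamma>\<^sup>l\<^sub>m a\<^sup>m) \<partial>/\<partial>y\<^sup>l\<close>.  The Leibniz rule together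
  with the values of \<open>\<nabla>\<close> on the frame \<open>\<partial>/\<partial>y\<^sup>j\<close> then gives
  \<open>\<nabla>\<^sub>X (Y\<^sup>j \<partial>/\<partial>y\<^sup>j) = (X(Y\<^sup>k) + Y\<^sup>j (\<Gamma>\<^sup>k\<^sub>j\<^sub>;\<^sub>l a\<^sup>l + \<Gamma>\<^sup>k\<^sub>j\<^sub>l (b\<^sup>l + \<Gamma>\<^sup>l\<^sub>m a\<^sup>m))) \<partial>/\<partial>y\<^sup>k\<close>.\<close>

definition cartan_nabla :: "('m, 'n::finite) chart set \<Rightarrow> (('m, 'n) hpoint \<Rightarrow> real) \<Rightarrow> ('m, 'n) hpoint
    \<Rightarrow> ('m, 'n) rvec \<Rightarrow> (('m, 'n) hpoint \<Rightarrow> ('m, 'n) rvec) \<Rightarrow> ('m, 'n) rvec" where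
  "cartan_nabla A F u X Y = (\<lambda>c.
     if c \<in> A \<and> fst u \<in> fst c then
       (let L = F2_loc A F c; w = coords c u; a = fst (X c); b = snd (X c); Yc = snd (Y u c) in
        (0, \<chi> k. frechet_derivative (\<lambda>w'. snd (Y (param A c w') c) $ k) (at w) (X c)
             + (\<Sum>j\<in>UNIV. \<Sum>l\<in>UNIV. Yc $ j *
                  (cartan_h L k j l w * a $ l
                   + cartan_v L k j l w * (b $ l + (\<Sum>m\<in>UNIV. nonlin L l m w * a $ m))))))
     else 0)"

end

theory Submission
  imports Defs
begin

text \<open>
  The claim is local. On horizontal vectors the Cartan connection involves only the coefficients
  \<open>\<Gamma>\<^sup>k\<^sub>j\<^sub>;\<^sub>l\<close> of \<open>cartan_h\<close>, so \<open>\<nabla>\<^sub>X \<^bold>J = 0\<close> says that for each \<open>l\<close> the matrix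
  \<open>(\<Gamma>\<^sup>k\<^sub>j\<^sub>;\<^sub>l)\<^sub>k\<^sub>j\<close> of real size \<open>2n\<close> is complex linear. It is complex linear because on every
  fibre it is the real form of the complex matrix \<open>(\<Gamma>\<^sup>\<alpha>\<^sub>\<beta>\<^sub>;\<^sub>\<mu>)\<close>; this identity
  (\<open>cartan_h_eq_C\<close>) is the heart of the proof.

  It is obtained as follows. Write \<open>L = F\<^sup>2\<close>. Complex homogeneity of \<open>F\<close> yields two Euler identities
  for \<open>L\<close> in the fibre direction. Differentiating them gives
  \<open>\<Gamma>\<^sup>\<alpha>\<^sub>;\<^sub>\<mu> = \<Gamma>\<^sup>\<alpha>\<^sub>\<beta>\<^sub>;\<^sub>\<mu> v\<^sup>\<beta>\<close> and \<open>\<delta>\<^sub>\<mu> L = 0\<close>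
  (\<open>complex_horizontal_constancy\<close>). For a Kaehler-Berwald metric \<open>\<Gamma>\<^sup>\<alpha>\<^sub>\<beta>\<^sub>;\<^sub>\<mu>\<close> is constant on
  the fibre and symmetric in \<open>\<beta>, \<mu>\<close>; let \<open>C\<^sup>k\<^sub>j\<^sub>l\<close> be its real form and
  \<open>N\<^sup>k\<^sub>j = C\<^sup>k\<^sub>j\<^sub>l y\<^sup>l\<close>. Then \<open>\<delta>\<^sub>\<mu> L = 0\<close> becomes the real equation
  \<open>\<partial>L/\<partial>x\<^sup>j = N\<^sup>k\<^sub>j \<partial>L/\<partial>y\<^sup>k\<close> (\<open>horizontal_constancy\<close>).

  Both sides may be differentiated along the fibre, where \<open>C\<close> is a constant. One derivative gives
  the spray \<open>(1/2) C\<^sup>k\<^sub>a\<^sub>b y\<^sup>a y\<^sup>b\<close>, hence \<open>N\<close> is the nonlinear connection of \<open>F\<close>. Two derivatives give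
  \<open>\<delta>\<^sub>l g\<^sub>s\<^sub>j = C\<^sup>m\<^sub>l\<^sub>s g\<^sub>m\<^sub>j + C\<^sup>m\<^sub>l\<^sub>j g\<^sub>m\<^sub>s\<close>, that is, \<open>C\<close> is metric. Being also
  symmetric, \<open>C\<close> is given by the Christoffel formula that defines \<open>\<Gamma>\<^sup>k\<^sub>j\<^sub>;\<^sub>l\<close>.
\<close>

section \<open>Directional derivatives of smooth functions\<close>

abbreviation dird :: "'a::real_normed_vector \<Rightarrow> ('a \<Rightarrow> 'b::real_normed_vector) \<Rightarrow> 'a \<Rightarrow> 'b" where
  "dird v f x \<equiv> frechet_derivative f (at x) v"

lemma dird_eqI: "(f has_derivative f') (at x) \<Longrightarrow> dird v f x = f' v"
  by (simp add: frechet_derivative_at[symmetric])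

lemma dird_bounded_linear:
  assumes "bounded_linear h" "f differentiable (at x)"
  shows "dird v (\<lambda>y. h (f y)) x = h (dird v f x)"
    and "(\<lambda>y. h (f y)) differentiable (at x)"
proof -
  have *: "((\<lambda>y. h (f y)) has_derivative (\<lambda>v. h (dird v f x))) (at x)"
    using assms by (auto intro: bounded_linear.has_derivative simp: frechet_derivative_works)
  show "dird v (\<lambda>y. h (f y)) x = h (dird v f x)" by (rule dird_eqI[OF *])
  show "(\<lambda>y. h (f y)) differentiable (at x)" using * by (rule differentiableI)
qed

lemma dird_add:
  assumes "f differentiable (at x)" "g differentiable (at x)"
  shows "dird v (\<lambda>y. f y + g y) x = dird v f x + dird v g x"
  by (rule dird_eqI[where f' = "\<lambda>v. dird v f x + dird v g x"], intro has_derivative_add)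
     (use assms in \<open>simp_all add: frechet_derivative_works\<close>)

lemma dird_sum:
  assumes "finite I" "\<And>i. i \<in> I \<Longrightarrow> f i differentiable (at x)"
  shows "dird v (\<lambda>y. \<Sum>i\<in>I. f i y) x = (\<Sum>i\<in>I. dird v (f i) x)"
  by (rule dird_eqI[where f' = "\<lambda>v. \<Sum>i\<in>I. dird v (f i) x"], intro has_derivative_sum)
     (use assms in \<open>simp_all add: frechet_derivative_works\<close>)

lemma dird_bilinear:
  assumes "bounded_bilinear B" "f differentiable (at x)" "g differentiable (at x)"
  shows "dird v (\<lambda>y. B (f y) (g y)) x = B (f x) (dird v g x) + B (dird v f x) (g x)"
    and "(\<lambda>y. B (f y) (g y)) differentiable (at x)"
proof -
  have *: "((\<lambda>y. B (f y) (g y)) has_derivative (\<lambda>v. B (f x) (dird v g x) + B (dird v f x) (g x))) (at x)"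
    using bounded_bilinear.FDERIV[OF assms(1)] assms(2,3) by (simp add: frechet_derivative_works)
  show "dird v (\<lambda>y. B (f y) (g y)) x = B (f x) (dird v g x) + B (dird v f x) (g x)"
    by (rule dird_eqI[OF *])
  show "(\<lambda>y. B (f y) (g y)) differentiable (at x)" using * by (rule differentiableI)
qed

lemma dird_cong:
  assumes "open S" "x \<in> S" "\<And>y. y \<in> S \<Longrightarrow> f y = g y" "f differentiable (at x)"
  shows "dird v f x = dird v g x"
  using frechet_derivative_transform_within_open[OF assms(4,1,2,3)] by simp

lemma differentiable_cong:
  assumes "open S" "x \<in> S" "\<And>y. y \<in> S \<Longrightarrow> f y = g y" "f differentiable (at x)"
  shows "g differentiable (at x)"
  using assms has_derivative_transform_within_open unfolding differentiable_def by metis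

lemma diff_class_on_cong:
  assumes "open S" "\<And>x. x \<in> S \<Longrightarrow> f x = g x" "diff_class_on k S f"
  shows "diff_class_on k S g"
  using assms(2,3)
proof (induction k arbitrary: f g)
  case 0
  then show ?case by (auto cong: continuous_on_cong)
next
  case (Suc k)
  have "g differentiable (at x)" if "x \<in> S" for x
    using differentiable_cong[OF assms(1) that Suc.prems(1)] Suc.prems(2) that by simp
  moreover have "diff_class_on k S (dird v g)" for v
    by (rule Suc.IH[of "dird v f"])
      (use Suc.prems in \<open>auto intro!: dird_cong[OF assms(1)]\<close>)
  ultimately show ?case by simp
qed

lemma diff_class_on_bounded_linear:
  assumes "open S" "bounded_linear h" "diff_class_on k S f"
  shows "diff_class_on k S (\<lambda>x. h (f x))"
  using assms(3)
proof (induction k arbitrary: f)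
  case 0
  then show ?case using bounded_linear.continuous_on[OF assms(2)] by simp
next
  case (Suc k)
  have "diff_class_on k S (dird v (\<lambda>x. h (f x)))" for v
    by (rule diff_class_on_cong[OF assms(1), of "\<lambda>x. h (dird v f x)"])
      (use Suc in \<open>auto simp: dird_bounded_linear(1)[OF assms(2)]\<close>)
  then show ?case using Suc.prems dird_bounded_linear(2)[OF assms(2)] by auto
qed

lemma diff_class_on_add:
  assumes "open S" "diff_class_on k S f" "diff_class_on k S g"
  shows "diff_class_on k S (\<lambda>x. f x + g x)"
  using assms(2,3)
proof (induction k arbitrary: f g)
  case 0
  then show ?case by (auto intro: continuous_on_add)
next
  case (Suc k)
  have "diff_class_on k S (dird v (\<lambda>x. f x + g x))" for v
    by (rule diff_class_on_cong[OF assms(1), of "\<lambda>x. dird v f x + dird v g x"])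
      (use Suc in \<open>auto simp: dird_add\<close>)
  then show ?case using Suc.prems by simp
qed

lemma diff_class_on_Suc_imp: "diff_class_on (Suc k) S f \<Longrightarrow> diff_class_on k S f"
proof (induction k arbitrary: f)
  case 0
  then show ?case
    by (auto intro!: continuous_at_imp_continuous_on differentiable_imp_continuous_within)
qed auto

lemma diff_class_on_bilinear:
  assumes "open S" "bounded_bilinear B" "diff_class_on k S f" "diff_class_on k S g"
  shows "diff_class_on k S (\<lambda>x. B (f x) (g x))"
  using assms(3,4)
proof (induction k arbitrary: f g)
  case 0
  then show ?case using bounded_bilinear.continuous_on[OF assms(2)] by auto
next
  case (Suc k)
  have "diff_class_on k S (dird v (\<lambda>x. B (f x) (g x)))" for v
    by (rule diff_class_on_cong[OF assms(1), of "\<lambda>x. B (f x) (dird v g x) + B (dird v f x) (g x)"],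
        force simp: dird_bilinear(1)[OF assms(2)] Suc.prems[simplified],
        intro diff_class_on_add[OF assms(1)] Suc.IH)
      (use Suc.prems diff_class_on_Suc_imp in auto)
  then show ?case using Suc.prems by (auto intro!: dird_bilinear(2)[OF assms(2)])
qed

lemma diff_class_on_const: "diff_class_on k S (\<lambda>x. c)"
  by (induction k arbitrary: c) auto

lemma smooth_on_differentiable: "smooth_on S f \<Longrightarrow> x \<in> S \<Longrightarrow> f differentiable (at x)"
  unfolding smooth_on_def using diff_class_on.simps(2) by blast

lemma smooth_on_dird: "smooth_on S f \<Longrightarrow> smooth_on S (dird v f)"
  unfolding smooth_on_def using diff_class_on.simps(2) by blast

lemma smooth_on_continuous: "smooth_on S f \<Longrightarrow> continuous_on S f"
  unfolding smooth_on_def using diff_class_on.simps(1) by blast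

lemma smooth_on_bounded_linear:
  "open S \<Longrightarrow> bounded_linear h \<Longrightarrow> smooth_on S f \<Longrightarrow> smooth_on S (\<lambda>x. h (f x))"
  by (simp add: smooth_on_def diff_class_on_bounded_linear)

lemma smooth_on_add: "open S \<Longrightarrow> smooth_on S f \<Longrightarrow> smooth_on S g \<Longrightarrow> smooth_on S (\<lambda>x. f x + g x)"
  by (simp add: smooth_on_def diff_class_on_add)

lemma smooth_on_bilinear:
  "open S \<Longrightarrow> bounded_bilinear B \<Longrightarrow> smooth_on S f \<Longrightarrow> smooth_on S g \<Longrightarrow>
    smooth_on S (\<lambda>x. B (f x) (g x))"
  by (simp add: smooth_on_def diff_class_on_bilinear)

lemma smooth_on_mult:
  fixes f g :: "'a::real_normed_vector \<Rightarrow> 'b::real_normed_algebra"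
  shows "open S \<Longrightarrow> smooth_on S f \<Longrightarrow> smooth_on S g \<Longrightarrow> smooth_on S (\<lambda>x. f x * g x)"
  by (rule smooth_on_bilinear[OF _ bounded_bilinear_mult])

lemma smooth_on_const: "smooth_on S (\<lambda>x. c)"
  by (simp add: smooth_on_def diff_class_on_const)

lemma smooth_on_linear: 
  assumes "bounded_linear h" shows "smooth_on S h"
  unfolding smooth_on_def
proof
  fix k
  have d: "(h has_derivative h) (at x)" for x
    using assms by (rule bounded_linear_imp_has_derivative)
  have "dird v h = (\<lambda>x. h v)" for v
    by (rule ext) (rule dird_eqI[OF d])
  then show "diff_class_on k S h"
    using d by (cases k) (auto simp: diff_class_on_const differentiable_def
      intro!: linear_continuous_on assms)
qed

lemma smooth_on_sum:
  "open S \<Longrightarrow> finite I \<Longrightarrow> (\<And>i. i \<in> I \<Longrightarrow> smooth_on S (f i)) \<Longrightarrow> smooth_on S (\<lambda>x. \<Sum>i\<in>I. f i x)"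
  by (rotate_tac 1, induction I rule: finite_induct) (auto intro: smooth_on_const smooth_on_add)

section \<open>Symmetry of second derivatives\<close>

lemma has_real_derivative_along_line:
  fixes f :: "'a::real_normed_vector \<Rightarrow> real"
  assumes "f differentiable (at (x + s *\<^sub>R v))"
  shows "((\<lambda>s. f (x + s *\<^sub>R v)) has_real_derivative dird v f (x + s *\<^sub>R v)) (at s)"
proof -
  let ?D = "\<lambda>h. dird h f (x + s *\<^sub>R v)"
  have f: "(f has_derivative ?D) (at (x + s *\<^sub>R v))"
    using assms by (simp add: frechet_derivative_works)
  have "((\<lambda>s. f (x + s *\<^sub>R v)) has_derivative (\<lambda>t. ?D (t *\<^sub>R v))) (at s)"
    by (rule has_derivative_compose[of "\<lambda>s. x + s *\<^sub>R v" "\<lambda>t. t *\<^sub>R v" s UNIV f ?D])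
       (auto intro!: derivative_eq_intros f)
  moreover have "?D (t *\<^sub>R v) = ?D v * t" for t
    using linear_frechet_derivative[OF assms] by (simp add: linear_cmul)
  ultimately show ?thesis by (simp add: has_field_derivative_def mult_commute_abs)
qed

text \<open>Two applications of the mean value theorem turn the second difference of \<open>f\<close> over the
  parallelogram spanned by \<open>h v\<close> and \<open>h w\<close> into \<open>h\<^sup>2\<close> times a mixed second derivative.\<close>

lemma second_difference_mean_value:
  fixes f :: "'a::real_normed_vector \<Rightarrow> real"
  assumes h: "0 < h"
    and S: "\<And>s t. 0 \<le> s \<Longrightarrow> s \<le> h \<Longrightarrow> 0 \<le> t \<Longrightarrow> t \<le> h \<Longrightarrow> x + s *\<^sub>R v + t *\<^sub>R w \<in> S"
    and f: "\<And>y. y \<in> S \<Longrightarrow> f differentiable (at y)"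
    and fv: "\<And>y. y \<in> S \<Longrightarrow> dird v f differentiable (at y)"
  obtains s t where "0 < s" "s < h" "0 < t" "t < h"
    "f (x + h *\<^sub>R v + h *\<^sub>R w) - f (x + h *\<^sub>R v) - f (x + h *\<^sub>R w) + f x
      = h * (h * dird w (dird v f) (x + s *\<^sub>R v + t *\<^sub>R w))"
proof -
  have "((\<lambda>s. f ((x + h *\<^sub>R w) + s *\<^sub>R v) - f (x + s *\<^sub>R v)) has_real_derivative
      dird v f ((x + h *\<^sub>R w) + s *\<^sub>R v) - dird v f (x + s *\<^sub>R v)) (at s)" if "0 \<le> s" "s \<le> h" for s
    using S[of s h] S[of s 0] that h
    by (intro derivative_intros has_real_derivative_along_line f) (auto simp: algebra_simps)
  from MVT2[OF h this] obtain s where s: "0 < s" "s < h"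
    "f (x + h *\<^sub>R w + h *\<^sub>R v) - f (x + h *\<^sub>R v) - (f (x + h *\<^sub>R w) - f x)
      = h * (dird v f (x + h *\<^sub>R w + s *\<^sub>R v) - dird v f (x + s *\<^sub>R v))"
    by auto
  have "((\<lambda>t. dird v f ((x + s *\<^sub>R v) + t *\<^sub>R w)) has_real_derivative
      dird w (dird v f) ((x + s *\<^sub>R v) + t *\<^sub>R w)) (at t)" if "0 \<le> t" "t \<le> h" for t
    using S[of s t] s that by (intro has_real_derivative_along_line fv) auto
  from MVT2[OF h this] obtain t where "0 < t" "t < h"
    "dird v f (x + s *\<^sub>R v + h *\<^sub>R w) - dird v f (x + s *\<^sub>R v)
      = h * dird w (dird v f) (x + s *\<^sub>R v + t *\<^sub>R w)"
    by auto
  with s that[of s t] show ?thesis by (simp add: algebra_simps)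
qed

text \<open>Up to the factor \<open>h\<^sup>2\<close> the same second difference is a value of either mixed derivative near \<open>x\<close>;
  by continuity the two mixed derivatives cannot differ at \<open>x\<close>.\<close>

lemma dird_commute_real:
  fixes f :: "'a::real_normed_vector \<Rightarrow> real"
  assumes S: "open S" "x \<in> S" and f: "smooth_on S f"
  shows "dird v (dird w f) x = dird w (dird v f) x"
proof (rule ccontr)
  let ?a = "dird v (dird w f)" and ?b = "dird w (dird v f)"
  assume ne: "?a x \<noteq> ?b x"
  define e where "e = \<bar>?a x - ?b x\<bar> / 2"
  have e: "e > 0" using ne by (simp add: e_def)
  have cont: "isCont ?a x" "isCont ?b x"
    using smooth_on_continuous[OF smooth_on_dird[OF smooth_on_dird[OF f]]] S
    by (auto simp: continuous_on_eq_continuous_at)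
  obtain d1 where d1: "d1 > 0" "\<And>y. dist y x < d1 \<Longrightarrow> dist (?a y) (?a x) < e"
    using cont(1) e unfolding continuous_at_eps_delta by blast
  obtain d2 where d2: "d2 > 0" "\<And>y. dist y x < d2 \<Longrightarrow> dist (?b y) (?b x) < e"
    using cont(2) e unfolding continuous_at_eps_delta by blast
  obtain d3 where d3: "d3 > 0" "\<And>y. dist y x < d3 \<Longrightarrow> y \<in> S"
    using S open_dist by metis
  define d where "d = min d1 (min d2 d3)"
  have d: "d > 0" using d1 d2 d3 by (simp add: d_def)
  \<comment> \<open>The parallelogram spanned by \<open>h v\<close> and \<open>h w\<close> then stays within distance \<open>d\<close> of \<open>x\<close>.\<close>
  define h where "h = d / (2 * (norm v + norm w + 1))"
  have pos: "norm v + norm w + 1 > 0" by (simp add: add_nonneg_pos)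
  have h: "h > 0" using d pos by (simp add: h_def)
  have near: "dist (x + s *\<^sub>R v + t *\<^sub>R w) x < d" if "0 \<le> s" "s \<le> h" "0 \<le> t" "t \<le> h" for s t
  proof -
    have "dist (x + s *\<^sub>R v + t *\<^sub>R w) x \<le> norm (s *\<^sub>R v) + norm (t *\<^sub>R w)"
      using norm_triangle_ineq[of "s *\<^sub>R v" "t *\<^sub>R w"] by (simp add: dist_norm algebra_simps)
    also have "\<dots> \<le> h * norm v + h * norm w"
      using that by (auto intro!: add_mono mult_right_mono)
    also have "\<dots> \<le> h * (norm v + norm w + 1)" using h by (simp add: algebra_simps)
    also have "\<dots> = d / 2" using pos by (simp add: h_def field_simps)
    also have "\<dots> < d" using d by simp
    finally show ?thesis .
  qed
  have diff: "f differentiable (at y)" "dird u f differentiable (at y)" if "y \<in> S" for y u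
    using that f smooth_on_dird[OF f] smooth_on_differentiable by blast+
  have inS: "x + s *\<^sub>R v + t *\<^sub>R w \<in> S" if "0 \<le> s" "s \<le> h" "0 \<le> t" "t \<le> h" for s t
    using near[OF that] d3 by (simp add: d_def)
  then have inS': "x + s *\<^sub>R w + t *\<^sub>R v \<in> S" if "0 \<le> s" "s \<le> h" "0 \<le> t" "t \<le> h" for s t
    using that by (metis add.assoc add.commute)
  obtain s t where st: "0 < s" "s < h" "0 < t" "t < h"
    "f (x + h *\<^sub>R v + h *\<^sub>R w) - f (x + h *\<^sub>R v) - f (x + h *\<^sub>R w) + f x
      = h * (h * ?b (x + s *\<^sub>R v + t *\<^sub>R w))"
    by (rule second_difference_mean_value[OF h inS diff])
  obtain s' t' where st': "0 < s'" "s' < h" "0 < t'" "t' < h"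
    "f (x + h *\<^sub>R w + h *\<^sub>R v) - f (x + h *\<^sub>R w) - f (x + h *\<^sub>R v) + f x
      = h * (h * ?a (x + s' *\<^sub>R w + t' *\<^sub>R v))"
    by (rule second_difference_mean_value[OF h inS' diff])
  have comm: "x + s' *\<^sub>R w + t' *\<^sub>R v = x + t' *\<^sub>R v + s' *\<^sub>R w" "x + h *\<^sub>R w + h *\<^sub>R v = x + h *\<^sub>R v + h *\<^sub>R w"
    by simp_all
  have "h * (h * ?b (x + s *\<^sub>R v + t *\<^sub>R w)) = h * (h * ?a (x + t' *\<^sub>R v + s' *\<^sub>R w))"
    using st(5) st'(5) unfolding comm by linarith
  then have "?b (x + s *\<^sub>R v + t *\<^sub>R w) = ?a (x + t' *\<^sub>R v + s' *\<^sub>R w)"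
    using h by simp
  moreover have "dist (?b (x + s *\<^sub>R v + t *\<^sub>R w)) (?b x) < e"
    using near[of s t] st by (intro d2) (simp add: d_def)
  moreover have "dist (?a (x + t' *\<^sub>R v + s' *\<^sub>R w)) (?a x) < e"
    using near[of t' s'] st' by (intro d1) (simp add: d_def)
  moreover have False if "\<bar>p - b\<bar> < \<bar>a - b\<bar> / 2" "\<bar>p - a\<bar> < \<bar>a - b\<bar> / 2" for p a b :: real
    using that by (auto simp: abs_if split: if_splits)
  ultimately show False unfolding e_def dist_real_def by metis
qed

lemma dird_commute:
  fixes f :: "'a::real_normed_vector \<Rightarrow> 'b::euclidean_space"
  assumes S: "open S" "x \<in> S" and f: "smooth_on S f"
  shows "dird v (dird w f) x = dird w (dird v f) x"
proof (rule euclidean_eqI)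
  fix b :: 'b assume "b \<in> Basis"
  have *: "dird v (dird w f) x \<bullet> b = dird v (dird w (\<lambda>y. f y \<bullet> b)) x" for v w
  proof -
    have "dird v (dird w f) x \<bullet> b = dird v (\<lambda>y. dird w f y \<bullet> b) x"
      using smooth_on_differentiable[OF smooth_on_dird[OF f] S(2)]
      by (simp add: dird_bounded_linear(1)[OF bounded_linear_inner_left])
    also have "\<dots> = dird v (dird w (\<lambda>y. f y \<bullet> b)) x"
      using smooth_on_differentiable[OF smooth_on_dird[OF f] S(2)] smooth_on_differentiable[OF f]
      by (intro dird_cong[OF S])
        (auto simp: dird_bounded_linear[OF bounded_linear_inner_left])
    finally show ?thesis .
  qed
  show "dird v (dird w f) x \<bullet> b = dird w (dird v f) x \<bullet> b"
    unfolding * using smooth_on_bounded_linear[OF S(1) bounded_linear_inner_left f]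
    by (rule dird_commute_real[OF S])
qed

section \<open>Complex directional derivatives\<close>

text \<open>The derivatives by \<open>z\<^sup>\<alpha>\<close>, by \<open>v\<^sup>\<alpha>\<close> and by the conjugate of \<open>v\<^sup>\<alpha>\<close> all have this shape, so
  that the Leibniz rule and commutation need to be shown only once.\<close>

definition cdir :: "complex \<Rightarrow> 'a \<Rightarrow> complex \<Rightarrow> 'a \<Rightarrow> ('a::real_normed_vector \<Rightarrow> complex) \<Rightarrow> 'a \<Rightarrow> complex" where
  "cdir a d b e f w = a * dird d f w + b * dird e f w"

lemma dz_eq_cdir: "dz \<alpha> = cdir (1/2) (axis (Inl \<alpha>) 1, 0) (- \<i>/2) (axis (Inr \<alpha>) 1, 0)"
  and dv_eq_cdir: "dv \<alpha> = cdir (1/2) (0, axis (Inl \<alpha>) 1) (- \<i>/2) (0, axis (Inr \<alpha>) 1)"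
  and dvbar_eq_cdir: "dvbar \<alpha> = cdir (1/2) (0, axis (Inl \<alpha>) 1) (\<i>/2) (0, axis (Inr \<alpha>) 1)"
  by (auto simp: fun_eq_iff dz_def dv_def dvbar_def dx_def dy_def cdir_def field_simps)

lemma smooth_on_cdir: "open S \<Longrightarrow> smooth_on S f \<Longrightarrow> smooth_on S (cdir a d b e f)"
  unfolding cdir_def[abs_def]
  by (intro smooth_on_add smooth_on_mult smooth_on_const smooth_on_dird)

lemma cdir_cong:
  assumes "open S" "w \<in> S" "\<And>y. y \<in> S \<Longrightarrow> f y = g y" "smooth_on S f"
  shows "cdir a d b e f w = cdir a d b e g w"
  using dird_cong[OF assms(1-3) smooth_on_differentiable[OF assms(4,2)]] by (simp add: cdir_def)

lemma cdir_sum_mult: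
  assumes "finite I" "\<And>i. i \<in> I \<Longrightarrow> p i differentiable (at w)" "\<And>i. i \<in> I \<Longrightarrow> q i differentiable (at w)"
  shows "cdir a d b e (\<lambda>y. \<Sum>i\<in>I. p i y * q i y) w
    = (\<Sum>i\<in>I. cdir a d b e (p i) w * q i w) + (\<Sum>i\<in>I. p i w * cdir a d b e (q i) w)"
proof -
  have "dird v (\<lambda>y. \<Sum>i\<in>I. p i y * q i y) w
      = (\<Sum>i\<in>I. p i w * dird v (q i) w + dird v (p i) w * q i w)" for v
    using assms by (simp add: dird_sum dird_bilinear(1)[OF bounded_bilinear_mult])
  then show ?thesis
    by (simp add: cdir_def sum.distrib sum_distrib_left algebra_simps)
qed

lemma cdir_commute:
  assumes S: "open S" "w \<in> S" and f: "smooth_on S f"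
  shows "cdir a d b e (cdir a' d' b' e' f) w = cdir a' d' b' e' (cdir a d b e f) w"
proof -
  have diff: "dird u f differentiable (at w)" for u
    using smooth_on_differentiable[OF smooth_on_dird[OF f] S(2)] .
  have *: "dird u (cdir p x q y f) w = p * dird u (dird x f) w + q * dird u (dird y f) w" for u p x q y
    unfolding cdir_def[abs_def]
    using diff dird_bounded_linear[OF bounded_linear_mult_right diff]
    by (subst dird_add) auto
  show ?thesis
    unfolding cdir_def[of a d b e "cdir _ _ _ _ _"] cdir_def[of a' d' b' e' "cdir _ _ _ _ _"] *
    using dird_commute[OF S f] by (simp add: algebra_simps)
qed

section \<open>Complex fibre coordinates\<close>

definition vcoord :: "'n::finite \<Rightarrow> 'n rcoord \<times> 'n rcoord \<Rightarrow> complex" where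
  "vcoord \<alpha> w = Complex (snd w $ Inl \<alpha>) (snd w $ Inr \<alpha>)"

lemma bounded_linear_vcoord: "bounded_linear (vcoord \<alpha>)"
  and bounded_linear_cnj_vcoord: "bounded_linear (\<lambda>w. cnj (vcoord \<alpha> w))"
  unfolding linear_conv_bounded_linear[symmetric]
  by (rule linearI; simp add: vcoord_def complex_eq_iff)+

lemma dird_vcoord: "dird e (vcoord \<alpha>) w = vcoord \<alpha> e"
  and dird_cnj_vcoord: "dird e (\<lambda>w. cnj (vcoord \<alpha> w)) w = cnj (vcoord \<alpha> e)"
  by (rule dird_eqI bounded_linear_imp_has_derivative bounded_linear_vcoord bounded_linear_cnj_vcoord)+

lemma vcoord_derivatives [simp]:
  "dz \<mu> (vcoord \<alpha>) w = 0" "dz \<mu> (\<lambda>w. cnj (vcoord \<alpha> w)) w = 0"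
  "dv \<mu> (vcoord \<alpha>) w = (if \<mu> = \<alpha> then 1 else 0)" "dv \<mu> (\<lambda>w. cnj (vcoord \<alpha> w)) w = 0"
  "dvbar \<mu> (vcoord \<alpha>) w = 0"
  unfolding dz_eq_cdir dv_eq_cdir dvbar_eq_cdir cdir_def dird_vcoord dird_cnj_vcoord
  by (auto simp: vcoord_def axis_def complex_eq_iff)

lemma sum_UNIV_Plus:
  fixes f :: "'n::finite + 'n \<Rightarrow> 'b::comm_monoid_add"
  shows "(\<Sum>j\<in>UNIV. f j) = (\<Sum>\<alpha>\<in>UNIV. f (Inl \<alpha>)) + (\<Sum>\<alpha>\<in>UNIV. f (Inr \<alpha>))"
  using sum.Plus[of "UNIV :: 'n set" "UNIV :: 'n set" f] by simp

section \<open>Inverse matrices\<close>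

lemma matrix_inv_inverse:
  fixes B :: "'a::field^'k^'k"
  assumes "invertible B"
  shows "B ** matrix_inv B = mat 1" "matrix_inv B ** B = mat 1"
  using someI_ex[OF assms[unfolded invertible_def]] by (auto simp: matrix_inv_def)

lemma matrix_inv_components:
  fixes B :: "'a::field^'k^'k"
  assumes "invertible B"
  shows "(\<Sum>l\<in>UNIV. B $ i $ l * matrix_inv B $ l $ j) = (if i = j then 1 else 0)"
    and "(\<Sum>l\<in>UNIV. matrix_inv B $ i $ l * B $ l $ j) = (if i = j then 1 else 0)"
  using matrix_inv_inverse[OF assms] by (auto simp: vec_eq_iff matrix_matrix_mult_def mat_def)

lemma invertible_if_kernel_trivial:
  fixes B :: "'a::field^'k^'k"
  assumes "\<And>x. B *v x = 0 \<Longrightarrow> x = 0"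
  shows "invertible B"
  using assms matrix_left_invertible_ker invertible_left_inverse by blast

lemma pos_definite_imp_invertible: "pos_definite B \<Longrightarrow> invertible B"
  by (rule invertible_if_kernel_trivial) (force simp: pos_definite_def)

section \<open>A convex complex Finsler metric in one chart\<close>

text \<open>Multiplication of a fibre vector by the complex number \<open>t\<close>, in real coordinates.\<close>

definition cscale :: "complex \<Rightarrow> 'n::finite rcoord \<Rightarrow> 'n rcoord" where
  "cscale t y = Re t *\<^sub>R y + Im t *\<^sub>R J_coord y"

text \<open>The data of a strongly convex complex Finsler metric in the induced coordinates of one chart: \<open>L\<close>
  is \<open>F\<^sup>2\<close> and \<open>S\<close> is the coordinate domain with the zero section removed.\<close>

locale local_finsler =
  fixes S :: "('n::finite rcoord \<times> 'n rcoord) set" and L :: "'n rfun"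
  assumes open_S: "open S"
    and smooth_L: "smooth_on S L"
    and homogeneous: "(x, y) \<in> S \<Longrightarrow> L (x, cscale t y) = (cmod t)\<^sup>2 * L (x, y)"
    and convex: "w \<in> S \<Longrightarrow> pos_definite (g_mat L w)"
begin

abbreviation Lc :: "'n cfun" where "Lc \<equiv> \<lambda>w. complex_of_real (L w)"

lemma smooth_Lc: "smooth_on S Lc"
  by (rule smooth_on_bounded_linear[OF open_S bounded_linear_of_real smooth_L])

lemma smooth_derivs:
  "smooth_on S f \<Longrightarrow> smooth_on S (dz \<alpha> f)" "smooth_on S f \<Longrightarrow> smooth_on S (dv \<alpha> f)"
  "smooth_on S f \<Longrightarrow> smooth_on S (dvbar \<alpha> f)"
  by (auto simp: dz_eq_cdir dv_eq_cdir dvbar_eq_cdir intro!: smooth_on_cdir open_S)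

lemma differentiable_S: "w \<in> S \<Longrightarrow> smooth_on S f \<Longrightarrow> f differentiable (at w)"
  using smooth_on_differentiable by blast

text \<open>The radial and the rotational Euler identity come from differentiating the homogeneity along
  \<open>t = 1 + s\<close> and along \<open>t = 1 + \<i>s\<close> at \<open>s = 0\<close>.\<close>

lemma euler_radial:
  assumes "(x, y) \<in> S" shows "dird (0, y) L (x, y) = 2 * L (x, y)"
proof -
  have "L ((x, y) + s *\<^sub>R (0, y)) = (1 + s)\<^sup>2 * L (x, y)" for s
    using homogeneous[OF assms, of "of_real (1 + s)"]
    by (simp add: cscale_def scaleR_add_left norm_of_real del: of_real_add)
  moreover have "((\<lambda>s. (1 + s)\<^sup>2 * L (x, y)) has_real_derivative 2 * L (x, y)) (at 0)"
    by (auto intro!: derivative_eq_intros)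
  moreover have "((\<lambda>s. L ((x, y) + s *\<^sub>R (0, y))) has_real_derivative dird (0, y) L (x, y)) (at 0)"
    using has_real_derivative_along_line[of L "(x, y)" 0 "(0, y)"] differentiable_S[OF assms smooth_L]
    by simp
  ultimately show ?thesis using DERIV_unique by simp
qed

lemma euler_rotational:
  assumes "(x, y) \<in> S" shows "dird (0, J_coord y) L (x, y) = 0"
proof -
  have "L ((x, y) + s *\<^sub>R (0, J_coord y)) = (1 + s\<^sup>2) * L (x, y)" for s
    using homogeneous[OF assms, of "Complex 1 s"] by (simp add: cscale_def cmod_power2)
  moreover have "((\<lambda>s. (1 + s\<^sup>2) * L (x, y)) has_real_derivative 0) (at 0)"
    by (auto intro!: derivative_eq_intros)
  moreover have "((\<lambda>s. L ((x, y) + s *\<^sub>R (0, J_coord y))) has_real_derivative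
      dird (0, J_coord y) L (x, y)) (at 0)"
    using has_real_derivative_along_line[of L "(x, y)" 0 "(0, J_coord y)"]
      differentiable_S[OF assms smooth_L]
    by simp
  ultimately show ?thesis using DERIV_unique by simp
qed

lemma dird_fibre_expansion:
  assumes "w \<in> S" shows "dird (0, y) L w = (\<Sum>j\<in>UNIV. y $ j * dy j L w)"
proof -
  interpret linear "\<lambda>v. dird v L w"
    using differentiable_S[OF assms smooth_L] by (rule linear_frechet_derivative)
  have "(0, y) = (\<Sum>j\<in>UNIV. y $ j *\<^sub>R (0 :: 'n rcoord, axis j 1 :: 'n rcoord))"
    by (simp add: prod_eq_iff fst_sum snd_sum vec_eq_iff axis_def if_distrib cong: if_cong)
  then show ?thesis by (simp only: sum scale dy_def real_scaleR_def)
qed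

lemma Lc_derivs:
  assumes "w \<in> S"
  shows "dz \<alpha> Lc w = (of_real (dx (Inl \<alpha>) L w) - \<i> * of_real (dx (Inr \<alpha>) L w)) / 2"
    and "dv \<alpha> Lc w = (of_real (dy (Inl \<alpha>) L w) - \<i> * of_real (dy (Inr \<alpha>) L w)) / 2"
    and "dvbar \<alpha> Lc w = (of_real (dy (Inl \<alpha>) L w) + \<i> * of_real (dy (Inr \<alpha>) L w)) / 2"
  using differentiable_S[OF assms smooth_L]
  by (simp_all add: dz_def dv_def dvbar_def dx_def dy_def dird_bounded_linear(1)[OF bounded_linear_of_real])

text \<open>The derivation \<open>v\<^sup>\<beta> \<partial>/\<partial>v\<^sup>\<beta>\<close> is half of the radial derivative minus \<open>\<i>\<close> times half of the
  rotational one, and \<open>L\<close> is invariant under rotation.\<close>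

lemma euler_holomorphic:
  assumes "w \<in> S" shows "(\<Sum>\<beta>\<in>UNIV. vcoord \<beta> w * dv \<beta> Lc w) = Lc w"
proof -
  obtain x y where w: "w = (x, y)" by (cases w)
  have r: "(\<Sum>\<beta>\<in>UNIV. y $ Inl \<beta> * dy (Inl \<beta>) L w) + (\<Sum>\<beta>\<in>UNIV. y $ Inr \<beta> * dy (Inr \<beta>) L w) = 2 * L w"
    using euler_radial dird_fibre_expansion[OF assms, of y] assms w by (simp add: sum_UNIV_Plus)
  have i: "(\<Sum>\<beta>\<in>UNIV. y $ Inl \<beta> * dy (Inr \<beta>) L w) - (\<Sum>\<beta>\<in>UNIV. y $ Inr \<beta> * dy (Inl \<beta>) L w) = 0"
    using euler_rotational dird_fibre_expansion[OF assms, of "J_coord y"] assms w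
    by (simp add: sum_UNIV_Plus J_coord_def sum_negf)
  have sw: "snd w = y" by (simp add: w)
  show ?thesis
    using r i
    by (simp add: complex_eq_iff Lc_derivs[OF assms] vcoord_def sw sum.distrib sum_subtractf sum_negf
        add_divide_distrib diff_divide_distrib sum_divide_distrib[symmetric] algebra_simps)
qed

lemma euler_antiholomorphic:
  assumes "w \<in> S" shows "(\<Sum>\<beta>\<in>UNIV. cnj (vcoord \<beta> w) * dvbar \<beta> Lc w) = Lc w"
proof -
  have "cnj (dv \<beta> Lc w) = dvbar \<beta> Lc w" for \<beta>
    by (simp add: Lc_derivs[OF assms])
  then show ?thesis
    using arg_cong[OF euler_holomorphic[OF assms], of cnj] by simp
qed

text \<open>All contraction identities below come from applying one of the complex derivatives \<open>D\<close> to an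
  identity \<open>\<Sum>\<^sub>\<beta> c\<^sub>\<beta> f\<^sub>\<beta> = h\<close> in which the \<open>c\<^sub>\<beta>\<close> are the fibre coordinates or their conjugates.\<close>

lemma cdir_euler:
  fixes f c :: "'n \<Rightarrow> 'n cfun"
  assumes D: "D = cdir a d b e" and w: "w \<in> S"
    and c: "\<And>\<beta>. bounded_linear (c \<beta>)" and f: "\<And>\<beta>. smooth_on S (f \<beta>)" and h: "smooth_on S h"
    and eq: "\<And>w. w \<in> S \<Longrightarrow> (\<Sum>\<beta>\<in>UNIV. c \<beta> w * f \<beta> w) = h w"
  shows "(\<Sum>\<beta>\<in>UNIV. D (c \<beta>) w * f \<beta> w) + (\<Sum>\<beta>\<in>UNIV. c \<beta> w * D (f \<beta>) w) = D h w"
proof -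
  have "D h w = D (\<lambda>w. \<Sum>\<beta>\<in>UNIV. c \<beta> w * f \<beta> w) w"
    unfolding D by (rule cdir_cong[OF open_S w]) (auto simp: eq h)
  then show ?thesis
    using differentiable_S[OF w f] differentiable_S[OF w smooth_on_linear[OF c]]
    by (simp add: cdir_sum_mult D)
qed

lemma smooth_G: "smooth_on S (\<lambda>w. G_mat L w $ \<alpha> $ \<beta>)"
  using smooth_derivs smooth_Lc by (auto simp: G_mat_def)

lemma G_contract_cnj_v:
  assumes "w \<in> S" shows "(\<Sum>\<tau>\<in>UNIV. cnj (vcoord \<tau> w) * G_mat L w $ \<alpha> $ \<tau>) = dv \<alpha> Lc w"
  using cdir_euler[OF dv_eq_cdir assms bounded_linear_cnj_vcoord _ smooth_Lc euler_antiholomorphic] smooth_derivs smooth_Lc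
  by (simp add: G_mat_def)

lemma dz_dvbar_contract_cnj_v:
  assumes "w \<in> S"
  shows "(\<Sum>\<tau>\<in>UNIV. cnj (vcoord \<tau> w) * dz \<mu> (dvbar \<tau> Lc) w) = dz \<mu> Lc w"
  using cdir_euler[OF dz_eq_cdir assms bounded_linear_cnj_vcoord _ smooth_Lc euler_antiholomorphic] smooth_derivs smooth_Lc
  by simp

lemma G_contract_v:
  assumes "w \<in> S" shows "(\<Sum>\<beta>\<in>UNIV. vcoord \<beta> w * G_mat L w $ \<beta> $ \<tau>) = dvbar \<tau> Lc w"
proof -
  have "dv \<beta> (dvbar \<tau> Lc) w = dvbar \<tau> (dv \<beta> Lc) w" for \<beta>
    unfolding dv_eq_cdir dvbar_eq_cdir by (rule cdir_commute[OF open_S assms smooth_Lc])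
  then show ?thesis
    using cdir_euler[OF dvbar_eq_cdir assms bounded_linear_vcoord _ smooth_Lc euler_holomorphic] smooth_derivs smooth_Lc
    by (simp add: G_mat_def)
qed

lemma dz_G_contract_v:
  assumes "w \<in> S"
  shows "(\<Sum>\<beta>\<in>UNIV. vcoord \<beta> w * dz \<mu> (\<lambda>w. G_mat L w $ \<beta> $ \<tau>) w) = dz \<mu> (dvbar \<tau> Lc) w"
  using cdir_euler[OF dz_eq_cdir assms bounded_linear_vcoord smooth_G smooth_derivs(3)[OF smooth_Lc] G_contract_v]
  by simp

text \<open>Differentiating \<open>G_contract_v\<close> by \<open>v\<^sup>\<sigma>\<close> reproduces \<open>G\<close> on both sides, so the remaining term
  vanishes: \<open>G\<close> is homogeneous of degree zero in \<open>v\<close>.\<close>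

lemma dv_G_contract_v:
  assumes "w \<in> S"
  shows "(\<Sum>\<beta>\<in>UNIV. vcoord \<beta> w * dv \<sigma> (\<lambda>w. G_mat L w $ \<beta> $ \<tau>) w) = 0"
proof -
  have 1: "(\<Sum>\<beta>\<in>UNIV. dv \<sigma> (vcoord \<beta>) w * G_mat L w $ \<beta> $ \<tau>)
      + (\<Sum>\<beta>\<in>UNIV. vcoord \<beta> w * dv \<sigma> (\<lambda>w. G_mat L w $ \<beta> $ \<tau>) w) = dv \<sigma> (dvbar \<tau> Lc) w"
    by (rule cdir_euler[OF dv_eq_cdir assms bounded_linear_vcoord smooth_G
        smooth_derivs(3)[OF smooth_Lc] G_contract_v])
  have 2: "(\<Sum>\<beta>\<in>UNIV. dv \<sigma> (vcoord \<beta>) w * G_mat L w $ \<beta> $ \<tau>) = dv \<sigma> (dvbar \<tau> Lc) w"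
    by (simp add: G_mat_def if_distrib[of "\<lambda>x. x * _"] cong: if_cong)
  show ?thesis using 1 unfolding 2 by simp
qed

lemma G_eq_g:
  assumes "w \<in> S"
  shows "G_mat L w $ \<alpha> $ \<beta> = Complex
    ((g_mat L w $ Inl \<alpha> $ Inl \<beta> + g_mat L w $ Inr \<alpha> $ Inr \<beta>) / 2)
    ((g_mat L w $ Inl \<alpha> $ Inr \<beta> - g_mat L w $ Inr \<alpha> $ Inl \<beta>) / 2)"
proof -
  let ?p = "dy (Inl \<beta>) L" and ?q = "dy (Inr \<beta>) L"
  have sm: "smooth_on S (dy j L)" for j
    unfolding dy_def[abs_def] by (rule smooth_on_dird[OF smooth_L])
  have "dv \<alpha> (dvbar \<beta> Lc) w
      = dv \<alpha> (\<lambda>w. complex_of_real (?p w) * (1/2) + complex_of_real (?q w) * (\<i>/2)) w"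
    unfolding dv_eq_cdir
    by (rule cdir_cong[OF open_S assms])
      (auto simp: Lc_derivs smooth_derivs smooth_Lc field_simps)
  moreover have "dird u (\<lambda>w. complex_of_real (?p w) * (1/2) + complex_of_real (?q w) * (\<i>/2)) w
      = complex_of_real (dird u ?p w) * (1/2) + complex_of_real (dird u ?q w) * (\<i>/2)" for u
  proof -
    have bl: "bounded_linear (\<lambda>r. complex_of_real r * c)" for c
      by (rule bounded_linear_compose[OF bounded_linear_mult_left bounded_linear_of_real])
    show ?thesis
      by (simp only: dird_add dird_bounded_linear[OF bl differentiable_S[OF assms sm]])
  qed
  ultimately show ?thesis
    unfolding G_mat_def g_mat_def
    by (simp add: dv_eq_cdir cdir_def complex_eq_iff dy_def[of "Inl \<alpha>"] dy_def[of "Inr \<alpha>"] field_simps)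
qed

text \<open>Positivity of the Hermitian form \<open>G\<close> is inherited from \<open>g\<close>: the coordinate vectors \<open>X1\<close> and \<open>X2\<close>
  are those of the conjugate of \<open>\<zeta>\<close> and of \<open>\<i>\<close> times it, and the cross terms combine to \<open>G_eq_g\<close>.\<close>

lemma G_form_eq_g_form:
  fixes \<zeta> :: "complex^'n"
  defines "X1 \<equiv> (\<chi> j. case j of Inl \<alpha> \<Rightarrow> Re (\<zeta> $ \<alpha>) | Inr \<alpha> \<Rightarrow> - Im (\<zeta> $ \<alpha>)) :: 'n rcoord"
    and "X2 \<equiv> (\<chi> j. case j of Inl \<alpha> \<Rightarrow> Im (\<zeta> $ \<alpha>) | Inr \<alpha> \<Rightarrow> Re (\<zeta> $ \<alpha>)) :: 'n rcoord"
  assumes w: "w \<in> S"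
  shows "X1 \<bullet> (g_mat L w *v X1) + X2 \<bullet> (g_mat L w *v X2)
    = 2 * Re (\<Sum>\<alpha>\<in>UNIV. cnj (\<zeta> $ \<alpha>) * (G_mat L w *v \<zeta>) $ \<alpha>)"
proof -
  define B where "B = g_mat L w"
  have "X \<bullet> (B *v X) = (\<Sum>\<alpha>\<in>UNIV. \<Sum>\<beta>\<in>UNIV.
      X $ Inl \<alpha> * (B $ Inl \<alpha> $ Inl \<beta> * X $ Inl \<beta>) + X $ Inl \<alpha> * (B $ Inl \<alpha> $ Inr \<beta> * X $ Inr \<beta>)
      + X $ Inr \<alpha> * (B $ Inr \<alpha> $ Inl \<beta> * X $ Inl \<beta>) + X $ Inr \<alpha> * (B $ Inr \<alpha> $ Inr \<beta> * X $ Inr \<beta>))" for X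
    by (simp add: inner_vec_def matrix_vector_mult_def sum_UNIV_Plus sum_distrib_left
        distrib_left sum.distrib)
  moreover have "2 * Re (\<Sum>\<alpha>\<in>UNIV. cnj (\<zeta> $ \<alpha>) * (G_mat L w *v \<zeta>) $ \<alpha>)
      = (\<Sum>\<alpha>\<in>UNIV. \<Sum>\<beta>\<in>UNIV. 2 * Re (cnj (\<zeta> $ \<alpha>) * (G_mat L w $ \<alpha> $ \<beta> * \<zeta> $ \<beta>)))"
    by (simp only: matrix_vector_mult_def vec_lambda_beta sum_distrib_left Re_sum)
  ultimately show ?thesis
    unfolding B_def[symmetric]
    by (simp only: sum.distrib[symmetric])
      (intro sum.cong refl; simp add: G_eq_g[OF w] B_def[symmetric] X1_def X2_def; simp add: field_simps)
qed

lemma G_invertible: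
  assumes w: "w \<in> S" shows "invertible (G_mat L w)"
proof (rule invertible_if_kernel_trivial, rule ccontr)
  fix \<zeta> assume 0: "G_mat L w *v \<zeta> = 0" and nz: "\<zeta> \<noteq> 0"
  define X1 X2 :: "'n rcoord" where
    "X1 = (\<chi> j. case j of Inl \<alpha> \<Rightarrow> Re (\<zeta> $ \<alpha>) | Inr \<alpha> \<Rightarrow> - Im (\<zeta> $ \<alpha>))" and
    "X2 = (\<chi> j. case j of Inl \<alpha> \<Rightarrow> Im (\<zeta> $ \<alpha>) | Inr \<alpha> \<Rightarrow> Re (\<zeta> $ \<alpha>))"
  let ?g = "g_mat L w"
  obtain \<alpha> where "\<zeta> $ \<alpha> \<noteq> 0" using nz by (auto simp: vec_eq_iff)
  then have "X1 $ Inl \<alpha> \<noteq> 0 \<or> X1 $ Inr \<alpha> \<noteq> 0" "X2 $ Inl \<alpha> \<noteq> 0 \<or> X2 $ Inr \<alpha> \<noteq> 0"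
    by (auto simp: X1_def X2_def complex_eq_iff)
  then have "X1 \<noteq> 0" "X2 \<noteq> 0" by auto
  then have "X1 \<bullet> (?g *v X1) + X2 \<bullet> (?g *v X2) > 0"
    using convex[OF w] by (simp add: pos_definite_def add_pos_pos)
  also have "X1 \<bullet> (?g *v X1) + X2 \<bullet> (?g *v X2) = 2 * Re (\<Sum>\<alpha>\<in>UNIV. cnj (\<zeta> $ \<alpha>) * (G_mat L w *v \<zeta>) $ \<alpha>)"
    unfolding X1_def X2_def by (rule G_form_eq_g_form[OF w])
  finally show False using 0 by simp
qed

lemma c_nonlin_G:
  assumes "w \<in> S"
  shows "(\<Sum>\<alpha>\<in>UNIV. c_nonlin L \<alpha> \<mu> w * G_mat L w $ \<alpha> $ \<sigma>) = dz \<mu> (dvbar \<sigma> Lc) w"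
proof -
  have "(\<Sum>\<alpha>\<in>UNIV. c_nonlin L \<alpha> \<mu> w * G_mat L w $ \<alpha> $ \<sigma>)
      = (\<Sum>\<tau>\<in>UNIV. (\<Sum>\<alpha>\<in>UNIV. G_inv L w $ \<tau> $ \<alpha> * G_mat L w $ \<alpha> $ \<sigma>) * dz \<mu> (dvbar \<tau> Lc) w)"
    unfolding c_nonlin_def sum_distrib_right by (subst sum.swap) (simp add: mult_ac)
  also have "\<dots> = dz \<mu> (dvbar \<sigma> Lc) w"
    unfolding G_inv_def matrix_inv_components[OF G_invertible[OF assms]]
    by (simp add: if_distrib[of "\<lambda>x. x * _"] cong: if_cong)
  finally show ?thesis .
qed

text \<open>In \<open>\<delta>\<^sub>\<mu> G\<^sub>\<beta>\<^sub>\<tau> v\<^sup>\<beta>\<close> the vertical part of \<open>\<delta>\<^sub>\<mu>\<close> drops out by \<open>dv_G_contract_v\<close>; the rest is the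
  definition of \<open>\<Gamma>\<^sup>\<alpha>\<^sub>;\<^sub>\<mu>\<close>.\<close>

lemma c_conn_contract_v:
  assumes "w \<in> S"
  shows "(\<Sum>\<beta>\<in>UNIV. c_conn L \<alpha> \<beta> \<mu> w * vcoord \<beta> w) = c_nonlin L \<alpha> \<mu> w"
proof -
  have "(\<Sum>\<beta>\<in>UNIV. vcoord \<beta> w * c_delta L \<mu> (\<lambda>w. G_mat L w $ \<beta> $ \<tau>) w) = dz \<mu> (dvbar \<tau> Lc) w" for \<tau>
  proof -
    have "(\<Sum>\<beta>\<in>UNIV. vcoord \<beta> w * (\<Sum>\<sigma>\<in>UNIV. c_nonlin L \<sigma> \<mu> w * dv \<sigma> (\<lambda>w. G_mat L w $ \<beta> $ \<tau>) w))
      = (\<Sum>\<sigma>\<in>UNIV. c_nonlin L \<sigma> \<mu> w * (\<Sum>\<beta>\<in>UNIV. vcoord \<beta> w * dv \<sigma> (\<lambda>w. G_mat L w $ \<beta> $ \<tau>) w))"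
      unfolding sum_distrib_left by (subst sum.swap) (simp add: mult_ac)
    then show ?thesis
      using dz_G_contract_v[OF assms] dv_G_contract_v[OF assms]
      by (simp add: c_delta_def right_diff_distrib sum_subtractf)
  qed
  moreover have "(\<Sum>\<beta>\<in>UNIV. c_conn L \<alpha> \<beta> \<mu> w * vcoord \<beta> w)
    = (\<Sum>\<tau>\<in>UNIV. G_inv L w $ \<tau> $ \<alpha> * (\<Sum>\<beta>\<in>UNIV. vcoord \<beta> w * c_delta L \<mu> (\<lambda>w. G_mat L w $ \<beta> $ \<tau>) w))"
    unfolding c_conn_def sum_distrib_left sum_distrib_right by (subst sum.swap) (simp add: mult_ac)
  ultimately show ?thesis by (simp add: c_nonlin_def)
qed

text \<open>This is \<open>\<delta>\<^sub>\<mu> L = 0\<close>. By \<open>G_contract_cnj_v\<close> the vertical part \<open>\<Gamma>\<^sup>\<alpha>\<^sub>;\<^sub>\<mu> \<partial>L/\<partial>v\<^sup>\<alpha>\<close> contains the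
  product of \<open>\<Gamma>\<^sup>\<alpha>\<^sub>;\<^sub>\<mu>\<close> with \<open>G\<close>, in which the inverse of \<open>G\<close> cancels.\<close>

lemma complex_horizontal_constancy:
  assumes "w \<in> S"
  shows "dz \<mu> Lc w = (\<Sum>\<alpha>\<in>UNIV. (\<Sum>\<beta>\<in>UNIV. c_conn L \<alpha> \<beta> \<mu> w * vcoord \<beta> w) * dv \<alpha> Lc w)"
proof -
  have "(\<Sum>\<alpha>\<in>UNIV. c_nonlin L \<alpha> \<mu> w * dv \<alpha> Lc w)
      = (\<Sum>\<alpha>\<in>UNIV. c_nonlin L \<alpha> \<mu> w * (\<Sum>\<tau>\<in>UNIV. cnj (vcoord \<tau> w) * G_mat L w $ \<alpha> $ \<tau>))"
    by (simp add: G_contract_cnj_v[OF assms])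
  also have "\<dots> = (\<Sum>\<tau>\<in>UNIV. cnj (vcoord \<tau> w) * (\<Sum>\<alpha>\<in>UNIV. c_nonlin L \<alpha> \<mu> w * G_mat L w $ \<alpha> $ \<tau>))"
    unfolding sum_distrib_left by (subst sum.swap) (simp add: mult_ac)
  also have "\<dots> = dz \<mu> Lc w"
    by (simp add: c_nonlin_G[OF assms] dz_dvbar_contract_cnj_v[OF assms])
  finally show ?thesis by (simp add: c_conn_contract_v[OF assms])
qed

end

section \<open>The real form of the connection coefficients\<close>

text \<open>The real coordinate vector with Latin index \<open>j\<close> is \<open>unit_of j\<close> times the complex coordinate vector
  with Greek index \<open>idx j\<close>, and \<open>part j\<close> reads off the real coordinate \<open>j\<close> from the complex
  coordinate \<open>idx j\<close>.\<close>

definition idx :: "'n + 'n \<Rightarrow> 'n" where "idx = case_sum id id"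

definition unit_of :: "'n + 'n \<Rightarrow> complex" where "unit_of = case_sum (\<lambda>_. 1) (\<lambda>_. \<i>)"

definition part :: "'n + 'n \<Rightarrow> complex \<Rightarrow> real" where "part = case_sum (\<lambda>_. Re) (\<lambda>_. Im)"

lemma index_simps [simp]:
  "idx (Inl \<alpha>) = \<alpha>" "idx (Inr \<alpha>) = \<alpha>" "unit_of (Inl \<alpha>) = 1" "unit_of (Inr \<alpha>) = \<i>"
  "part (Inl \<alpha>) = Re" "part (Inr \<alpha>) = Im"
  by (simp_all add: idx_def unit_of_def part_def)

lemma part_sum: "part k (\<Sum>i\<in>I. f i) = (\<Sum>i\<in>I. part k (f i))"
  and part_mult_of_real: "part k (x * of_real r) = part k x * r"
  by (cases k; simp)+

text \<open>The complex bilinear map with coefficients \<open>c\<close>, written in real coordinates.\<close>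

definition real_coeff ::
  "('n \<Rightarrow> 'n \<Rightarrow> 'n \<Rightarrow> complex) \<Rightarrow> 'n + 'n \<Rightarrow> 'n + 'n \<Rightarrow> 'n + 'n \<Rightarrow> real" where
  "real_coeff c k j l = part k (c (idx k) (idx j) (idx l) * unit_of j * unit_of l)"

text \<open>The real form of a complex bilinear map commutes with multiplication by \<open>\<i>\<close> in the argument with
  index \<open>j\<close>.\<close>

lemma real_coeff_J:
  fixes Y :: "'n::finite rcoord"
  shows "(\<Sum>j\<in>UNIV. J_coord Y $ j * real_coeff c k j l) =
    J_coord (\<chi> k. \<Sum>j\<in>UNIV. Y $ j * real_coeff c k j l) $ k"
  by (cases k; cases l; simp add: sum_UNIV_Plus J_coord_def real_coeff_def sum_negf)

section \<open>Derivatives along the fibres\<close>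

text \<open>Vertical derivatives only see the restriction to the fibre. Thus an identity whose coefficients are
  constant on a single fibre may be differentiated as if they were constant everywhere.
  Differentiability at \<open>(x, y)\<close> is what ties the Frechet derivative to its restriction.\<close>

lemma fibre_derivative_cong:
  fixes f g :: "'n::finite rcoord \<times> 'n rcoord \<Rightarrow> 'b::real_normed_vector"
  assumes S: "open S" "(x, y) \<in> S"
    and f: "f differentiable (at (x, y))" and g: "g differentiable (at (x, y))"
    and eq: "\<And>y'. (x, y') \<in> S \<Longrightarrow> f (x, y') = g (x, y')"
  shows "dy s f (x, y) = dy s g (x, y)"
proof -
  have along: "((\<lambda>y'. h (x, y')) has_derivative (\<lambda>e. dird (0, e) h (x, y))) (at y)"
    if "h differentiable (at (x, y))" for h :: "'n rcoord \<times> 'n rcoord \<Rightarrow> 'b"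
    by (rule has_derivative_compose[of "\<lambda>y'. (x, y')" "\<lambda>e. (0, e)" y UNIV h "\<lambda>v. dird v h (x, y)"])
       (use that in \<open>auto intro!: derivative_eq_intros simp: frechet_derivative_works\<close>)
  have "open (Pair x -` S)"
    by (rule open_vimage[OF S(1)]) (intro continuous_intros)
  then have "((\<lambda>y'. f (x, y')) has_derivative (\<lambda>e. dird (0, e) g (x, y))) (at y)"
    by (rule has_derivative_transform_within_open[OF along[OF g]]) (use S eq in auto)
  from has_derivative_unique[OF along[OF f] this] show ?thesis
    by (simp add: dy_def fun_eq_iff)
qed

lemma (in local_finsler) smooth_dx: "smooth_on S f \<Longrightarrow> smooth_on S (dx j f)"
  and smooth_dy: "smooth_on S f \<Longrightarrow> smooth_on S (dy j f)"
  unfolding dx_def[abs_def] dy_def[abs_def] by (rule smooth_on_dird, assumption)+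

lemma (in local_finsler) dx_dy_commute:
  fixes f :: "'n rfun"
  shows "w \<in> S \<Longrightarrow> smooth_on S f \<Longrightarrow> dx j (dy k f) w = dy k (dx j f) w"
  unfolding dx_def[abs_def] dy_def[abs_def] by (rule dird_commute_real[OF open_S])

lemma (in local_finsler) dy_commute:
  fixes f :: "'n rfun"
  shows "w \<in> S \<Longrightarrow> smooth_on S f \<Longrightarrow> dy j (dy k f) w = dy k (dy j f) w"
  unfolding dy_def[abs_def] by (rule dird_commute_real[OF open_S])

lemma (in local_finsler) dy_sum_mult:
  fixes p q :: "'i \<Rightarrow> 'n rfun"
  assumes "w \<in> S" "finite I" "\<And>i. i \<in> I \<Longrightarrow> smooth_on S (p i)" "\<And>i. i \<in> I \<Longrightarrow> smooth_on S (q i)"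
  shows "dy s (\<lambda>w. \<Sum>i\<in>I. p i w * q i w) w
    = (\<Sum>i\<in>I. dy s (p i) w * q i w) + (\<Sum>i\<in>I. p i w * dy s (q i) w)"
proof -
  have "p i differentiable (at w)" "q i differentiable (at w)" if "i \<in> I" for i
    using that assms smooth_on_differentiable by blast+
  then show ?thesis
    using assms(2)
    by (simp add: dy_def dird_sum dird_bilinear(1)[OF bounded_bilinear_mult] sum.distrib add.commute)
qed

section \<open>Kaehler-Berwald metrics on one fibre\<close>

text \<open>Over a fixed base point \<open>x0\<close> the connection coefficients are numbers \<open>c\<close>; the Kaehler condition
  makes them symmetric.\<close>

locale local_kaehler_berwald = local_finsler S L
  for S :: "('n::finite rcoord \<times> 'n rcoord) set" and L :: "'n rfun" +
  fixes x0 :: "'n rcoord" and c :: "'n \<Rightarrow> 'n \<Rightarrow> 'n \<Rightarrow> complex"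
  assumes conn: "(x0, y) \<in> S \<Longrightarrow> c_conn L \<alpha> \<beta> \<mu> (x0, y) = c \<alpha> \<beta> \<mu>"
    and torsion_free: "c \<alpha> \<beta> \<mu> = c \<alpha> \<mu> \<beta>"
begin

abbreviation C :: "'n + 'n \<Rightarrow> 'n + 'n \<Rightarrow> 'n + 'n \<Rightarrow> real" where "C \<equiv> real_coeff c"

text \<open>By \<open>nonlin_eq_N\<close> below these are the coefficients of the nonlinear connection on the fibre over \<open>x0\<close>.\<close>

definition N :: "'n + 'n \<Rightarrow> 'n + 'n \<Rightarrow> 'n rfun" where
  "N k j w = (\<Sum>l\<in>UNIV. C k j l * snd w $ l)"

lemma C_sym: "C k j l = C k l j"
  using torsion_free by (simp add: real_coeff_def mult_ac)

lemma bounded_linear_N: "bounded_linear (N k j)"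
  unfolding linear_conv_bounded_linear[symmetric]
  by (rule linearI)
    (simp_all add: N_def[abs_def] distrib_left sum.distrib sum_distrib_left mult_ac)

lemma dy_N: "dy s (N k j) w = C k j s"
  unfolding dy_def dird_eqI[OF bounded_linear_imp_has_derivative[OF bounded_linear_N]]
  by (simp add: N_def axis_def if_distrib[of "\<lambda>x. _ * x"] cong: if_cong)

lemma smooth_N: "smooth_on S (N k j)"
  by (rule smooth_on_linear[OF bounded_linear_N])

lemma N_eq_part:
  "N k j w = part k (unit_of j * (\<Sum>\<beta>\<in>UNIV. c (idx k) \<beta> (idx j) * vcoord \<beta> w))"
proof -
  have "(\<Sum>\<beta>\<in>UNIV. c (idx k) \<beta> (idx j) * vcoord \<beta> w)
      = (\<Sum>l\<in>UNIV. c (idx k) (idx l) (idx j) * unit_of l * of_real (snd w $ l))"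
    by (simp add: sum_UNIV_Plus vcoord_def Complex_eq distrib_left sum.distrib mult_ac)
  then have "unit_of j * (\<Sum>\<beta>\<in>UNIV. c (idx k) \<beta> (idx j) * vcoord \<beta> w)
      = (\<Sum>l\<in>UNIV. c (idx k) (idx l) (idx j) * unit_of j * unit_of l * of_real (snd w $ l))"
    by (simp only: sum_distrib_left mult_ac)
  then show ?thesis
    by (simp only: N_def real_coeff_def part_sum part_mult_of_real torsion_free[of _ "idx j"])
qed

text \<open>This is twice the real part of \<open>\<delta>\<^sub>\<mu> L = 0\<close>, multiplied by \<open>\<i>\<close> when \<open>j\<close> belongs to an imaginary
  coordinate.\<close>

lemma horizontal_constancy:
  assumes "(x0, y) \<in> S"
  shows "dx j L (x0, y) = (\<Sum>k\<in>UNIV. N k j (x0, y) * dy k L (x0, y))"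
proof -
  let ?w = "(x0, y)"
  let ?Z = "\<lambda>\<alpha>. unit_of j * (\<Sum>\<beta>\<in>UNIV. c \<alpha> \<beta> (idx j) * vcoord \<beta> ?w)"
  have "dx j L ?w = 2 * Re (unit_of j * dz (idx j) Lc ?w)"
    by (cases j) (simp_all add: Lc_derivs[OF assms])
  also have "unit_of j * dz (idx j) Lc ?w = (\<Sum>\<alpha>\<in>UNIV. ?Z \<alpha> * dv \<alpha> Lc ?w)"
    by (simp add: complex_horizontal_constancy[OF assms] conn[OF assms] sum_distrib_left mult_ac)
  also have "2 * Re \<dots> = (\<Sum>\<alpha>\<in>UNIV. 2 * Re (?Z \<alpha> * dv \<alpha> Lc ?w))"
    by (simp only: Re_sum sum_distrib_left)
  also have "\<dots> = (\<Sum>\<alpha>\<in>UNIV. Re (?Z \<alpha>) * dy (Inl \<alpha>) L ?w + Im (?Z \<alpha>) * dy (Inr \<alpha>) L ?w)"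
    by (rule sum.cong[OF refl]) (simp add: Lc_derivs[OF assms] field_simps)
  also have "\<dots> = (\<Sum>k\<in>UNIV. N k j ?w * dy k L ?w)"
    unfolding sum_UNIV_Plus N_eq_part index_simps by (simp only: sum.distrib)
  finally show ?thesis .
qed

text \<open>First vertical derivative of \<open>horizontal_constancy\<close>; it determines the spray.\<close>

lemma dy_dx_L:
  assumes "(x0, y) \<in> S"
  shows "dy s (dx j L) (x0, y)
    = (\<Sum>k\<in>UNIV. C k j s * dy k L (x0, y)) + (\<Sum>k\<in>UNIV. N k j (x0, y) * dy s (dy k L) (x0, y))"
proof -
  have "dy s (dx j L) (x0, y) = dy s (\<lambda>w. \<Sum>k\<in>UNIV. N k j w * dy k L w) (x0, y)"
    by (rule fibre_derivative_cong[OF open_S assms])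
      (auto intro!: differentiable_S[OF assms] smooth_on_sum smooth_on_mult open_S smooth_N
        smooth_dx smooth_dy smooth_L horizontal_constancy)
  then show ?thesis
    using dy_sum_mult[where I = UNIV and p = "\<lambda>k. N k j" and q = "\<lambda>k. dy k L" and s = s,
        OF assms finite_class.finite_UNIV smooth_N smooth_dy[OF smooth_L]]
    by (simp add: dy_N)
qed

text \<open>Second vertical derivative of \<open>horizontal_constancy\<close>; it determines \<open>\<delta>\<^sub>l g\<^sub>s\<^sub>j\<close>.\<close>

lemma dy_dy_dx_L:
  assumes "(x0, y) \<in> S"
  shows "dy t (dy s (dx j L)) (x0, y)
    = (\<Sum>k\<in>UNIV. C k j s * dy t (dy k L) (x0, y)) + (\<Sum>k\<in>UNIV. C k j t * dy s (dy k L) (x0, y))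
      + (\<Sum>k\<in>UNIV. N k j (x0, y) * dy t (dy s (dy k L)) (x0, y))"
proof -
  let ?f = "\<lambda>w. \<Sum>k\<in>UNIV. C k j s * dy k L w" and ?g = "\<lambda>w. \<Sum>k\<in>UNIV. N k j w * dy s (dy k L) w"
  have sm: "smooth_on S ?f" "smooth_on S ?g"
    by (auto intro!: smooth_on_sum smooth_on_mult open_S smooth_N smooth_on_const smooth_dy smooth_L)
  have "dy t (dy s (dx j L)) (x0, y) = dy t (\<lambda>w. ?f w + ?g w) (x0, y)"
    by (rule fibre_derivative_cong[OF open_S assms])
      (auto intro!: differentiable_S[OF assms] smooth_on_add open_S sm smooth_dy smooth_dx smooth_L dy_dx_L)
  also have "\<dots> = dy t ?f (x0, y) + dy t ?g (x0, y)"
    using differentiable_S[OF assms] sm unfolding dy_def[of t] by (intro dird_add) auto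
  also have "dy t ?f (x0, y) = (\<Sum>k\<in>UNIV. C k j s * dy t (dy k L) (x0, y))"
    using dy_sum_mult[where I = UNIV and p = "\<lambda>k _. C k j s" and q = "\<lambda>k. dy k L" and s = t,
        OF assms finite_class.finite_UNIV smooth_on_const smooth_dy[OF smooth_L]]
    by (simp add: dy_def[of t "\<lambda>_. C _ _ _"])
  also have "dy t ?g (x0, y) = (\<Sum>k\<in>UNIV. C k j t * dy s (dy k L) (x0, y))
      + (\<Sum>k\<in>UNIV. N k j (x0, y) * dy t (dy s (dy k L)) (x0, y))"
    using dy_sum_mult[where I = UNIV and p = "\<lambda>k. N k j" and q = "\<lambda>k. dy s (dy k L)" and s = t,
        OF assms finite_class.finite_UNIV smooth_N smooth_dy[OF smooth_dy[OF smooth_L]]]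
    by (simp add: dy_N)
  finally show ?thesis by (simp add: add.assoc)
qed

end

section \<open>The inverse metric is differentiable\<close>

text \<open>The nonlinear connection is a derivative of the spray, and the spray contains the inverse of \<open>g\<close>.
  Cramer's rule expresses that inverse by determinants.\<close>

lemma differentiable_det:
  fixes B :: "'a::real_normed_vector \<Rightarrow> real^'k^'k"
  assumes "\<And>i j. (\<lambda>w. B w $ i $ j) differentiable (at w)"
  shows "(\<lambda>w. det (B w)) differentiable (at w)"
proof -
  have "(\<lambda>w. \<Prod>i\<in>UNIV. B w $ i $ p i) differentiable (at w)" for p :: "'k \<Rightarrow> 'k"
    by (rule differentiableI, rule has_derivative_prod, rule assms[unfolded frechet_derivative_works])
  then show ?thesis
    unfolding det_def by (intro differentiable_sum differentiable_mult) auto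
qed

lemma matrix_inv_cramer:
  fixes B :: "real^'k^'k"
  assumes "invertible B"
  shows "matrix_inv B $ k $ l = det (\<chi> i j. if j = k then (if i = l then 1 else 0) else B $ i $ j) / det B"
proof -
  have "B *v (matrix_inv B *v axis l 1) = axis l 1"
    by (simp add: matrix_vector_mul_assoc matrix_inv_inverse[OF assms])
  then have "matrix_inv B *v axis l 1
      = (\<chi> k. det (\<chi> i j. if j = k then axis l 1 $ i else B $ i $ j) / det B)"
    using assms by (subst cramer[symmetric]) (auto simp: invertible_det_nz)
  moreover have "matrix_inv B $ k $ l = (matrix_inv B *v axis l 1) $ k"
    by (simp add: matrix_vector_mult_basis column_def)
  ultimately show ?thesis by (simp only: vec_lambda_beta axis_def)
qed

lemma differentiable_matrix_inv:
  fixes B :: "'a::real_normed_vector \<Rightarrow> real^'k^'k"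
  assumes S: "open S" "w \<in> S" and inv: "\<And>w. w \<in> S \<Longrightarrow> invertible (B w)"
    and B: "\<And>i j. (\<lambda>w. B w $ i $ j) differentiable (at w)"
  shows "(\<lambda>w. matrix_inv (B w) $ k $ l) differentiable (at w)"
proof (rule differentiable_cong[OF S])
  show "(\<lambda>w. det (\<chi> i j. if j = k then (if i = l then 1 else 0) else B w $ i $ j) / det (B w))
      differentiable (at w)"
  proof (intro differentiable_divide differentiable_det B)
    show "(\<lambda>w. (\<chi> i j. if j = k then if i = l then 1 else 0 else B w $ i $ j) $ i $ j)
        differentiable (at w)" for i j
      using B by (cases "j = k") auto
  qed (use inv[OF S(2)] in \<open>simp add: invertible_det_nz\<close>)
qed (simp add: matrix_inv_cramer[OF inv])

context local_finsler
begin

lemma smooth_g: "smooth_on S (\<lambda>w. g_mat L w $ j $ k)"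
proof -
  have "bounded_linear (\<lambda>r::real. r / 2)" by (rule bounded_linear_divide)
  then show ?thesis
    using smooth_on_bounded_linear[OF open_S _ smooth_dy[OF smooth_dy[OF smooth_L]]]
    by (simp add: g_mat_def)
qed

lemma g_invertible: "w \<in> S \<Longrightarrow> invertible (g_mat L w)"
  by (intro pos_definite_imp_invertible convex)

lemma differentiable_g_inv: "w \<in> S \<Longrightarrow> (\<lambda>w. g_inv L w $ k $ l) differentiable (at w)"
  unfolding g_inv_def
  by (rule differentiable_matrix_inv[OF open_S])
    (auto intro: g_invertible differentiable_S smooth_g)

lemma differentiable_spray:
  assumes w: "w \<in> S" shows "spray L k differentiable (at w)"
proof -
  have "bounded_linear (\<lambda>w::'n rcoord \<times> 'n rcoord. snd w $ a)" for a
    by (rule bounded_linear_compose[OF bounded_linear_vec_nth bounded_linear_snd])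
  then have "(\<lambda>w::'n rcoord \<times> 'n rcoord. snd w $ a) differentiable (at w)" for a
    using bounded_linear_imp_has_derivative unfolding differentiable_def by blast
  then show ?thesis
    unfolding spray_def[abs_def]
    by (intro differentiable_divide differentiable_sum ballI differentiable_mult differentiable_diff
        differentiable_g_inv[OF w] differentiable_const
        differentiable_S[OF w smooth_dx[OF smooth_dy[OF smooth_L]]]
        differentiable_S[OF w smooth_dx[OF smooth_L]]) simp_all
qed

lemma g_inv_g:
  assumes "w \<in> S" shows "(\<Sum>l\<in>UNIV. g_inv L w $ k $ l * g_mat L w $ l $ m) = (if k = m then 1 else 0)"
  unfolding g_inv_def by (rule matrix_inv_components[OF g_invertible[OF assms]])

lemma g_inv_contract:
  assumes "w \<in> S"
  shows "(\<Sum>l\<in>UNIV. g_inv L w $ k $ l * (\<Sum>m\<in>UNIV. g_mat L w $ l $ m * M m)) = M k"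
proof -
  have "(\<Sum>l\<in>UNIV. g_inv L w $ k $ l * (\<Sum>m\<in>UNIV. g_mat L w $ l $ m * M m))
      = (\<Sum>m\<in>UNIV. (\<Sum>l\<in>UNIV. g_inv L w $ k $ l * g_mat L w $ l $ m) * M m)"
    unfolding sum_distrib_left sum_distrib_right by (subst sum.swap) (simp add: mult_ac)
  then show ?thesis
    by (simp add: g_inv_g[OF assms] if_distrib[of "\<lambda>x. x * _"] cong: if_cong)
qed

end

section \<open>The Cartan connection on a Kaehler-Berwald fibre\<close>

context local_kaehler_berwald
begin

text \<open>The terms with a first derivative of \<open>L\<close> cancel by the symmetry of \<open>C\<close>, and \<open>g\<close> times its inverse
  cancels in the remaining term.\<close>

lemma spray_quadratic:
  assumes "(x0, y) \<in> S"
  shows "spray L k (x0, y) = (\<Sum>a\<in>UNIV. N k a (x0, y) * y $ a) / 2"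
proof -
  let ?w = "(x0, y)"
  have "(\<Sum>a\<in>UNIV. dx a (dy l L) ?w * y $ a) - dx l L ?w
      = (\<Sum>m\<in>UNIV. g_mat L ?w $ l $ m * (2 * (\<Sum>a\<in>UNIV. N m a ?w * y $ a)))" for l
  proof -
    have "(\<Sum>a\<in>UNIV. dx a (dy l L) ?w * y $ a)
        = (\<Sum>a\<in>UNIV. (\<Sum>m\<in>UNIV. C m a l * dy m L ?w * y $ a))
          + (\<Sum>a\<in>UNIV. (\<Sum>m\<in>UNIV. N m a ?w * dy l (dy m L) ?w * y $ a))"
      by (simp add: dx_dy_commute[OF assms smooth_L] dy_dx_L[OF assms] distrib_right
          sum_distrib_right sum.distrib)
    also have "(\<Sum>a\<in>UNIV. (\<Sum>m\<in>UNIV. C m a l * dy m L ?w * y $ a)) = (\<Sum>m\<in>UNIV. N m l ?w * dy m L ?w)"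
      by (subst sum.swap) (simp add: N_def C_sym[of _ l] sum_distrib_right sum_distrib_left mult_ac)
    also have "(\<Sum>a\<in>UNIV. (\<Sum>m\<in>UNIV. N m a ?w * dy l (dy m L) ?w * y $ a))
        = (\<Sum>m\<in>UNIV. g_mat L ?w $ l $ m * (2 * (\<Sum>a\<in>UNIV. N m a ?w * y $ a)))"
      by (subst sum.swap) (simp add: g_mat_def sum_distrib_left mult_ac)
    finally show ?thesis by (simp add: horizontal_constancy[OF assms])
  qed
  then show ?thesis
    unfolding spray_def snd_conv by (simp add: g_inv_contract[OF assms])
qed

lemma nonlin_eq_N:
  assumes "(x0, y) \<in> S"
  shows "nonlin L k j (x0, y) = N k j (x0, y)"
proof -
  \<comment> \<open>The factor \<open>1/2\<close> of the spray is put on the coordinate \<open>y\<^sup>a\<close>; the two terms of the Leibniz rule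
    are then equal by the symmetry of \<open>C\<close>.\<close>
  have bl: "bounded_linear (\<lambda>w::'n rcoord \<times> 'n rcoord. snd w $ a)" for a
    by (rule bounded_linear_compose[OF bounded_linear_vec_nth bounded_linear_snd])
  have sm: "smooth_on S (\<lambda>w. snd w $ a / 2)" for a
    by (rule smooth_on_bounded_linear[OF open_S bounded_linear_divide smooth_on_linear[OF bl]])
  have d: "dy j (\<lambda>w. snd w $ a / 2) (x0, y) = (if a = j then 1 / 2 else 0)" for a
    unfolding dy_def
    by (subst dird_eqI[OF bounded_linear_imp_has_derivative[OF
            bounded_linear_compose[OF bounded_linear_divide bl]]])
      (simp add: axis_def)
  have "nonlin L k j (x0, y) = dy j (\<lambda>w. \<Sum>a\<in>UNIV. N k a w * (snd w $ a / 2)) (x0, y)"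
    unfolding nonlin_def
  proof (rule fibre_derivative_cong[OF open_S assms differentiable_spray[OF assms]])
    show "(\<lambda>w. \<Sum>a\<in>UNIV. N k a w * (snd w $ a / 2)) differentiable (at (x0, y))"
      by (intro differentiable_S[OF assms] smooth_on_sum smooth_on_mult open_S smooth_N sm) simp
  qed (simp add: spray_quadratic sum_divide_distrib)
  also have "\<dots> = (\<Sum>a\<in>UNIV. C k a j * (y $ a / 2)) + N k j (x0, y) / 2"
    using dy_sum_mult[where I = UNIV and p = "N k" and q = "\<lambda>a w. snd w $ a / 2" and s = j,
        OF assms finite_class.finite_UNIV smooth_N sm]
    by (simp add: dy_N d if_distrib[of "\<lambda>x. _ * x"] cong: if_cong)
  also have "(\<Sum>a\<in>UNIV. C k a j * (y $ a / 2)) = N k j (x0, y) / 2"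
    by (simp add: N_def C_sym[of k _ j] sum_divide_distrib)
  finally show ?thesis by simp
qed

text \<open>The third derivatives of \<open>L\<close> cancel because \<open>N\<close> is the nonlinear connection; what remains says that
  \<open>C\<close> is compatible with the metric.\<close>

lemma delta_g:
  assumes "(x0, y) \<in> S"
  shows "delta L l (\<lambda>w. g_mat L w $ s $ j) (x0, y)
    = (\<Sum>m\<in>UNIV. g_mat L (x0, y) $ j $ m * C m l s) + (\<Sum>m\<in>UNIV. g_mat L (x0, y) $ s $ m * C m l j)"
proof -
  let ?w = "(x0, y)"
  have half: "dird v (\<lambda>w. f w / 2) ?w = dird v f ?w / 2" if "smooth_on S f" for v and f :: "'n rfun"
    by (rule dird_bounded_linear(1)[OF bounded_linear_divide differentiable_S[OF assms that]])
  have sm: "smooth_on S (dy s (dy j L))" by (intro smooth_dy smooth_L)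
  have swap: "dy s (dx l (dy j L)) ?w = dy s (dy j (dx l L)) ?w"
    unfolding dy_def[of s]
    by (rule dird_cong[OF open_S assms])
      (auto simp: dx_dy_commute smooth_L intro!: differentiable_S[OF assms] smooth_dx smooth_dy smooth_L)
  have swap3: "dy k (dy s (dy j L)) ?w = dy s (dy j (dy k L)) ?w" for k
  proof -
    have "dy s (dy k (dy j L)) ?w = dy s (dy j (dy k L)) ?w"
      unfolding dy_def[of s]
      by (rule dird_cong[OF open_S assms])
        (auto simp: dy_commute smooth_L intro!: differentiable_S[OF assms] smooth_dx smooth_dy smooth_L)
    then show ?thesis by (simp add: dy_commute[OF assms smooth_dy[OF smooth_L]])
  qed
  have "dx l (dy s (dy j L)) ?w = dy s (dy j (dx l L)) ?w"
    using dx_dy_commute[OF assms smooth_dy[OF smooth_L]] swap by simp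
  also have "\<dots> = 2 * (\<Sum>m\<in>UNIV. g_mat L ?w $ s $ m * C m l j) + 2 * (\<Sum>m\<in>UNIV. g_mat L ?w $ j $ m * C m l s)
      + (\<Sum>k\<in>UNIV. N k l ?w * dy k (dy s (dy j L)) ?w)"
    by (simp add: dy_dy_dx_L[OF assms] swap3 g_mat_def sum_distrib_left mult_ac)
  finally have "dx l (dy s (dy j L)) ?w - (\<Sum>k\<in>UNIV. N k l ?w * dy k (dy s (dy j L)) ?w)
      = 2 * (\<Sum>m\<in>UNIV. g_mat L ?w $ s $ m * C m l j) + 2 * (\<Sum>m\<in>UNIV. g_mat L ?w $ j $ m * C m l s)"
    by simp
  moreover have "delta L l (\<lambda>w. g_mat L w $ s $ j) ?w
      = (dx l (dy s (dy j L)) ?w - (\<Sum>k\<in>UNIV. N k l ?w * dy k (dy s (dy j L)) ?w)) / 2"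
    by (simp add: delta_def g_mat_def nonlin_eq_N[OF assms] dx_def[of l] dy_def[of _ "\<lambda>w. _ w / 2"]
        half[OF sm] dy_def[of _ "dy s (dy j L)"] sum_divide_distrib diff_divide_distrib)
  ultimately show ?thesis by simp
qed

text \<open>The Christoffel argument: in the alternating sum of three instances of \<open>delta_g\<close> the symmetry of
  \<open>C\<close> cancels all but two equal terms.\<close>

lemma cartan_h_eq_C:
  assumes "(x0, y) \<in> S"
  shows "cartan_h L k j l (x0, y) = C k j l"
proof -
  let ?w = "(x0, y)"
  have "cartan_h L k j l ?w
      = (\<Sum>s\<in>UNIV. g_inv L ?w $ k $ s * (\<Sum>m\<in>UNIV. g_mat L ?w $ s $ m * C m l j))"
    unfolding cartan_h_def
    by (rule sum.cong[OF refl])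
      (simp add: delta_g[OF assms] C_sym[of _ j] C_sym[of _ _ l] C_sym[of _ s])
  then show ?thesis by (simp add: g_inv_contract[OF assms] C_sym[of k l])
qed

end

section \<open>Real and complex coordinates\<close>

definition unrealify :: "'n::finite rcoord \<Rightarrow> complex^'n" where
  "unrealify x = (\<chi> \<alpha>. Complex (x $ Inl \<alpha>) (x $ Inr \<alpha>))"

lemma unrealify_realify [simp]: "unrealify (realify z) = z"
  by (simp add: unrealify_def realify_def vec_eq_iff)

lemma realify_unrealify [simp]: "realify (unrealify x) = x"
  by (auto simp: unrealify_def realify_def vec_eq_iff split: sum.splits)

lemma realify_eq_iff [simp]: "realify z = realify z' \<longleftrightarrow> z = z'"
  by (metis unrealify_realify)

lemma realify_0 [simp]: "realify 0 = 0"
  by (auto simp: realify_def vec_eq_iff split: sum.splits)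

lemma realify_smult: "realify (t *s z) = cscale t (realify z)"
  by (auto simp: realify_def cscale_def J_coord_def vec_eq_iff split: sum.splits)

lemma continuous_on_unrealify: "continuous_on UNIV unrealify"
  unfolding unrealify_def[abs_def] Complex_eq by (intro continuous_intros)

section \<open>Charts of the holomorphic tangent bundle\<close>

locale holomorphic_atlas =
  fixes A :: "('m::{t2_space, second_countable_topology}, 'n::finite) chart set"
  assumes manifold: "complex_manifold A"
begin

lemma chart:
  assumes "c \<in> A"
  shows "open (fst c)" "open (snd c ` fst c)"
    "homeomorphism (fst c) (snd c ` fst c) (snd c) (inv_into (fst c) (snd c))"
    "d \<in> A \<Longrightarrow> holomorphic_map_on (snd c ` (fst c \<inter> fst d)) (transition c d)"
  using manifold assms by (auto simp: complex_manifold_def)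

lemma chart_inverse: "c \<in> A \<Longrightarrow> p \<in> fst c \<Longrightarrow> inv_into (fst c) (snd c) (snd c p) = p"
  using chart(3) unfolding homeomorphism_def by blast

lemma transition_chart: "c \<in> A \<Longrightarrow> p \<in> fst c \<Longrightarrow> transition c d (snd c p) = snd d p"
  by (simp add: transition_def chart_inverse)

lemma open_chart_image:
  assumes c: "c \<in> A" and V: "open V" "V \<subseteq> fst c"
  shows "open (snd c ` V)"
proof -
  have "openin (top_of_set (snd c ` fst c)) (snd c ` V)"
    using homeomorphism_imp_open_map[OF chart(3)[OF c]] V by (simp add: openin_open_eq chart(1)[OF c])
  then show ?thesis using chart(2)[OF c] openin_open_eq by blast
qed

abbreviation jac :: "('m, 'n) chart \<Rightarrow> ('m, 'n) chart \<Rightarrow> 'm \<Rightarrow> complex^'n \<Rightarrow> complex^'n" where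
  "jac c d p \<equiv> frechet_derivative (transition c d) (at (snd c p))"

lemma has_derivative_transition:
  assumes "c \<in> A" "d \<in> A" "p \<in> fst c" "p \<in> fst d"
  shows "(transition c d has_derivative jac c d p) (at (snd c p))"
    and "jac c d p (t *s h) = t *s jac c d p h"
proof -
  obtain D where D: "(transition c d has_derivative D) (at (snd c p))" "\<And>t h. D (t *s h) = t *s D h"
    using chart(4)[OF assms(1,2)] assms(3,4) unfolding holomorphic_map_on_def by blast
  have "D = jac c d p" by (rule frechet_derivative_at[OF D(1)])
  with D show "(transition c d has_derivative jac c d p) (at (snd c p))"
    "jac c d p (t *s h) = t *s jac c d p h" by auto
qed

text \<open>The chain rule for transition maps. It makes the components of one complex vector in one chart extend
  consistently to all charts, so that every point of the coordinate domain comes from a vector.\<close>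

lemma jac_cocycle:
  assumes A: "c \<in> A" "d \<in> A" "e \<in> A" and p: "p \<in> fst c" "p \<in> fst d" "p \<in> fst e"
  shows "jac d e p (jac c d p h) = jac c e p h"
proof -
  let ?V = "fst c \<inter> fst d \<inter> fst e"
  have "(transition d e has_derivative jac d e p) (at (transition c d (snd c p)))"
    using has_derivative_transition(1)[OF A(2,3) p(2,3)] A p by (simp add: transition_chart)
  from has_derivative_compose[OF has_derivative_transition(1)[OF A(1,2) p(1,2)] this]
  have "((\<lambda>z. transition d e (transition c d z)) has_derivative (\<lambda>h. jac d e p (jac c d p h)))
      (at (snd c p))" .
  moreover have "open (snd c ` ?V)"
    by (intro open_chart_image open_Int chart(1) A) auto
  ultimately have "(transition c e has_derivative (\<lambda>h. jac d e p (jac c d p h))) (at (snd c p))"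
    by (rule has_derivative_transform_within_open) (use A p in \<open>auto simp: transition_chart\<close>)
  then show ?thesis using frechet_derivative_at by metis
qed

lemma jac_self:
  assumes "c \<in> A" "p \<in> fst c" shows "jac c c p h = h"
proof -
  have "(transition c c has_derivative (\<lambda>h. h)) (at (snd c p))"
    by (rule has_derivative_transform_within_open[OF has_derivative_ident chart(2)[OF assms(1)]])
      (use assms in \<open>auto simp: transition_chart\<close>)
  then show ?thesis using frechet_derivative_at by metis
qed

lemma hol_tangent_exists:
  assumes c: "c \<in> A" "p \<in> fst c"
  obtains v where "v \<in> hol_tangent_space A p" "v c = z"
proof
  show "(\<lambda>d. if d \<in> A \<and> p \<in> fst d then jac c d p z else 0) \<in> hol_tangent_space A p"
    using c by (auto simp: hol_tangent_space_def jac_cocycle)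
qed (use c in \<open>simp add: jac_self\<close>)

lemma hol_tangent_jac:
  "v \<in> hol_tangent_space A p \<Longrightarrow> c \<in> A \<Longrightarrow> d \<in> A \<Longrightarrow> p \<in> fst c \<Longrightarrow> p \<in> fst d \<Longrightarrow> v d = jac c d p (v c)"
  unfolding hol_tangent_space_def by blast

lemma hol_tangent_outside:
  "v \<in> hol_tangent_space A p \<Longrightarrow> \<not> (c \<in> A \<and> p \<in> fst c) \<Longrightarrow> v c = 0"
  unfolding hol_tangent_space_def by blast

lemma hol_tangent_eqI:
  assumes c: "c \<in> A" "p \<in> fst c"
    and v: "v \<in> hol_tangent_space A p" "v' \<in> hol_tangent_space A p" "v c = v' c"
  shows "v = v'"
proof
  fix d show "v d = v' d"
    using hol_tangent_jac[OF v(1) c(1) _ c(2), of d] hol_tangent_jac[OF v(2) c(1) _ c(2), of d]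
      hol_tangent_outside[OF v(1), of d] hol_tangent_outside[OF v(2), of d] v(3)
    by metis
qed

lemma hol_tangent_smult:
  assumes "v \<in> hol_tangent_space A p" shows "(\<lambda>c. t *s v c) \<in> hol_tangent_space A p"
proof -
  have "t *s v d = jac c d p (t *s v c)" if "c \<in> A" "d \<in> A" "p \<in> fst c" "p \<in> fst d" for c d
    by (subst hol_tangent_jac[OF assms that]) (rule has_derivative_transition(2)[OF that, symmetric])
  moreover have "t *s v c = 0" if "\<not> (c \<in> A \<and> p \<in> fst c)" for c
    using hol_tangent_outside[OF assms that] by simp
  ultimately show ?thesis unfolding hol_tangent_space_def by blast
qed

lemma zero_hol_tangent: "v \<in> hol_tangent_space A p \<Longrightarrow> (\<lambda>_. 0) \<in> hol_tangent_space A p"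
  using hol_tangent_smult[of v p 0] by simp

lemma hol_tangent_zero_iff:
  assumes "c \<in> A" "p \<in> fst c" "v \<in> hol_tangent_space A p"
  shows "v = (\<lambda>_. 0) \<longleftrightarrow> v c = 0"
  using hol_tangent_eqI[OF assms zero_hol_tangent[OF assms(3)]] by auto

text \<open>A point of the bundle over a chart is determined by its coordinates, so \<open>param\<close> is a genuine inverse.\<close>

lemma param_coords:
  assumes c: "c \<in> A" and u: "u \<in> bundle_over A c"
  shows "param A c (coords c u) = u"
proof -
  have "inj_on (coords c) (bundle_over A c)"
  proof (rule inj_onI)
    fix u u' assume a: "u \<in> bundle_over A c" "u' \<in> bundle_over A c" "coords c u = coords c u'"
    then have "fst u = fst u'"
      using chart_inverse[OF c] by (auto simp: bundle_over_def coords_def) metis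
    moreover from this have "snd u = snd u'"
      using a hol_tangent_eqI[OF c] by (auto simp: bundle_over_def hol_bundle_def coords_def)
    ultimately show "u = u'" by (rule prod_eqI)
  qed
  then show ?thesis using u by (simp add: param_def)
qed

text \<open>Since the Jacobians are linear, a vector vanishes as soon as its components in one chart do.\<close>

lemma slit_domain_eq:
  assumes c: "c \<in> A"
  shows "slit_domain A c = {(x, y). unrealify x \<in> snd c ` fst c \<and> y \<noteq> 0}"
proof (intro set_eqI iffI)
  fix w assume "w \<in> slit_domain A c"
  then show "w \<in> {(x, y). unrealify x \<in> snd c ` fst c \<and> y \<noteq> 0}"
    using hol_tangent_zero_iff[OF c] realify_eq_iff[of _ 0]
    by (auto simp: slit_domain_def slit_bundle_def bundle_over_def hol_bundle_def coords_def
        simp del: realify_eq_iff)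
next
  fix w :: "'n rcoord \<times> 'n rcoord"
  assume "w \<in> {(x, y). unrealify x \<in> snd c ` fst c \<and> y \<noteq> 0}"
  then obtain x y p where w: "w = (x, y)" "unrealify x = snd c p" "p \<in> fst c" "y \<noteq> 0" by auto
  obtain v where v: "v \<in> hol_tangent_space A p" "v c = unrealify y"
    using hol_tangent_exists[OF c w(3)] .
  have x: "x = realify (snd c p)" using w(2) by (metis realify_unrealify)
  have "unrealify y \<noteq> 0" using w(4) by (metis realify_unrealify realify_0)
  then have "(p, v) \<in> slit_bundle A \<inter> bundle_over A c"
    using w v by (auto simp: slit_bundle_def bundle_over_def hol_bundle_def)
  moreover have "coords c (p, v) = w" by (simp add: coords_def w x v)
  ultimately show "w \<in> slit_domain A c" unfolding slit_domain_def by (metis image_eqI)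
qed

lemma open_slit_domain:
  assumes "c \<in> A" shows "open (slit_domain A c)"
proof -
  have "open ((\<lambda>w. unrealify (fst w)) -` (snd c ` fst c) \<inter> (\<lambda>w. snd w) -` (- {0 :: 'n rcoord}))"
    by (intro open_Int open_vimage chart(2)[OF assms] continuous_intros
        continuous_on_compose2[OF continuous_on_unrealify]) auto
  moreover have "slit_domain A c
      = (\<lambda>w. unrealify (fst w)) -` (snd c ` fst c) \<inter> (\<lambda>w. snd w) -` (- {0 :: 'n rcoord})"
    by (auto simp: slit_domain_eq[OF assms])
  ultimately show ?thesis by simp
qed

lemma F2_loc_homogeneous:
  assumes F: "strongly_convex_finsler A F" and c: "c \<in> A" and w: "(x, y) \<in> slit_domain A c"
  shows "F2_loc A F c (x, cscale t y) = (cmod t)\<^sup>2 * F2_loc A F c (x, y)"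
proof -
  obtain p v where u: "(p, v) \<in> bundle_over A c" "(x, y) = coords c (p, v)"
    using w by (auto simp: slit_domain_def)
  have "(p, \<lambda>c. t *s v c) \<in> bundle_over A c"
    using u(1) hol_tangent_smult by (simp add: bundle_over_def hol_bundle_def)
  moreover have "coords c (p, \<lambda>c. t *s v c) = (x, cscale t y)"
    using u(2) by (simp add: coords_def realify_smult)
  ultimately have "param A c (x, cscale t y) = (p, \<lambda>c. t *s v c)"
    using param_coords[OF c] by metis
  moreover have "param A c (x, y) = (p, v)" using param_coords[OF c u(1)] u(2) by simp
  moreover have "F (p, \<lambda>c. t *s v c) = cmod t * F (p, v)"
    using F u(1) by (auto simp: strongly_convex_finsler_def bundle_over_def)
  ultimately show ?thesis by (simp add: F2_loc_def F_loc_def power_mult_distrib)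
qed

lemma local_finsler_chart:
  assumes F: "strongly_convex_finsler A F" and c: "c \<in> A"
  shows "local_finsler (slit_domain A c) (F2_loc A F c)"
proof
  show "open (slit_domain A c)" by (rule open_slit_domain[OF c])
  then show "smooth_on (slit_domain A c) (F2_loc A F c)"
    using F c unfolding F2_loc_def[abs_def] power2_eq_square
    by (intro smooth_on_mult) (auto simp: strongly_convex_finsler_def)
next
  show "pos_definite (g_mat (F2_loc A F c) w)" if "w \<in> slit_domain A c" for w
    using F c that unfolding strongly_convex_finsler_def by blast
qed (rule F2_loc_homogeneous[OF F c])

lemma local_kaehler_berwald_chart:
  assumes F: "strongly_convex_finsler A F" "kaehler_berwald A F" and c: "c \<in> A"
    and w: "(x, y) \<in> slit_domain A c"
  shows "local_kaehler_berwald (slit_domain A c) (F2_loc A F c) x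
    (\<lambda>\<alpha> \<beta> \<mu>. c_conn (F2_loc A F c) \<alpha> \<beta> \<mu> (x, y))"
proof -
  interpret local_finsler "slit_domain A c" "F2_loc A F c"
    by (rule local_finsler_chart[OF F(1) c])
  show ?thesis
  proof
    show "c_conn (F2_loc A F c) \<alpha> \<beta> \<mu> (x, y') = c_conn (F2_loc A F c) \<alpha> \<beta> \<mu> (x, y)"
      if "(x, y') \<in> slit_domain A c" for y' \<alpha> \<beta> \<mu>
      using F(2) c w that unfolding kaehler_berwald_def complex_berwald_def by blast
    show "c_conn (F2_loc A F c) \<alpha> \<beta> \<mu> (x, y) = c_conn (F2_loc A F c) \<alpha> \<mu> \<beta> (x, y)" for \<alpha> \<beta> \<mu>
      using F(2) c w unfolding kaehler_berwald_def kaehler_finsler_def by blast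
  qed
qed

end

section \<open>Parallelism of the complex structure\<close>

lemma bounded_linear_J_coord_nth: "bounded_linear (\<lambda>y. J_coord y $ k)"
  unfolding linear_conv_bounded_linear[symmetric]
  by (rule linearI) (cases k; simp add: J_coord_def)+

lemma dird_J_coord:
  assumes "f differentiable (at w)"
  shows "dird X (\<lambda>w. J_coord (f w) $ k) w = J_coord (\<chi> k. dird X (\<lambda>w. f w $ k) w) $ k"
  unfolding dird_bounded_linear(1)[OF bounded_linear_J_coord_nth assms]
    dird_bounded_linear(1)[OF bounded_linear_vec_nth assms]
  by simp

lemma J_coord_sum_nth: "(\<Sum>i\<in>I. J_coord (y i) $ k * r i) = J_coord (\<chi> k. \<Sum>i\<in>I. y i $ k * r i) $ k"
  by (cases k) (simp_all add: J_coord_def sum_negf)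

lemma J_coord_add_nth: "J_coord y $ k + J_coord z $ k = J_coord (\<chi> k. y $ k + z $ k) $ k"
  by (cases k) (simp_all add: J_coord_def)

lemma J_coord_0: "J_coord 0 = 0"
  by (auto simp: J_coord_def vec_eq_iff split: sum.splits)

text \<open>The left-hand side is the argument of the coefficients \<open>cartan_v\<close> in \<open>cartan_nabla\<close>; horizontality
  makes it vanish.\<close>

lemma horizontal_vertical_part:
  assumes "X \<in> horizontal A F u" "c \<in> A" "fst u \<in> fst c"
  shows "snd (X c) $ l + (\<Sum>m\<in>UNIV. nonlin (F2_loc A F c) l m (coords c u) * fst (X c) $ m) = 0"
proof -
  let ?n = "\<lambda>l m. nonlin (F2_loc A F c) l m (coords c u)"
  have "X c \<in> span (range (\<lambda>j. (axis j 1, - (\<Sum>k\<in>UNIV. ?n k j *\<^sub>R axis k 1))))"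
    using assms by (auto simp: horizontal_def)
  then show ?thesis
  proof (induction rule: span_induct_alt)
    case base
    then show ?case by simp
  next
    case (step r z y)
    then obtain j where z: "z = (axis j 1, - (\<Sum>k\<in>UNIV. ?n k j *\<^sub>R axis k 1))" by auto
    have "snd z $ l + (\<Sum>m\<in>UNIV. ?n l m * fst z $ m) = 0"
      by (simp add: z axis_def if_distrib[of "\<lambda>x. _ * x"] cong: if_cong)
    then have "r * (snd z $ l + (\<Sum>m\<in>UNIV. ?n l m * fst z $ m)) + (snd y $ l + (\<Sum>m\<in>UNIV. ?n l m * fst y $ m)) = 0"
      using step.IH by simp
    then show ?case
      by (simp add: distrib_left sum.distrib sum_distrib_left mult_ac)
  qed
qed

theorem theorem3p13:
  fixes A :: "('m::{t2_space, second_countable_topology}, 'n::finite) chart set"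
    and F :: "('m, 'n) hpoint \<Rightarrow> real"
  assumes "complex_manifold A"
    and "CARD('n) \<ge> 2"
    and "strongly_convex_finsler A F"
    and "kaehler_berwald A F"
  shows "\<forall>W Y u X. open_in_bundle A W \<and> W \<subseteq> slit_bundle A \<and> vertical_section A W Y \<and>
           u \<in> W \<and> X \<in> horizontal A F u \<longrightarrow>
           cartan_nabla A F u X (\<lambda>u'. J_vec (Y u')) = J_vec (cartan_nabla A F u X Y)"
proof (intro allI impI, elim conjE, rule ext)
  interpret holomorphic_atlas A by unfold_locales (rule assms(1))
  fix W Y u X and c :: "('m, 'n) chart"
  assume W: "W \<subseteq> slit_bundle A" and Y: "vertical_section A W Y" and u: "u \<in> W"
    and X: "X \<in> horizontal A F u"
  show "cartan_nabla A F u X (\<lambda>u'. J_vec (Y u')) c = J_vec (cartan_nabla A F u X Y) c"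
  proof (cases "c \<in> A \<and> fst u \<in> fst c")
    case False
    \<comment> \<open>Outside the charts around the base point both sides have the dummy value \<open>0\<close>.\<close>
    then have "cartan_nabla A F u X Y' c = 0" for Y'
      unfolding cartan_nabla_def by (rule if_not_P)
    then show ?thesis by (simp add: J_vec_def J_coord_0 zero_prod_def)
  next
    case True
    then have c: "c \<in> A" "fst u \<in> fst c" by auto
    define L w a where "L = F2_loc A F c" and "w = coords c u" and "a = fst (X c)"
    define f where "f = (\<lambda>w. snd (Y (param A c w) c))"
    have u': "u \<in> W \<inter> bundle_over A c" 
      using u W c(2) by (auto simp: bundle_over_def slit_bundle_def)
    then have w: "w \<in> slit_domain A c"
      using W by (auto simp: slit_domain_def w_def)
    interpret local_kaehler_berwald "slit_domain A c" L "fst w"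
      "\<lambda>\<alpha> \<beta> \<mu>. c_conn L \<alpha> \<beta> \<mu> (fst w, snd w)"
      unfolding L_def by (rule local_kaehler_berwald_chart[OF assms(3,4) c(1)]) (simp add: w)
    have h: "cartan_h L k j l w = C k j l" for k j l
      using cartan_h_eq_C[of "snd w"] w by simp
    have v: "snd (X c) $ l + (\<Sum>m\<in>UNIV. nonlin L l m w * a $ m) = 0" for l
      unfolding L_def w_def a_def by (rule horizontal_vertical_part[OF X c])
    \<comment> \<open>The covariant derivative in the chart: the vertical coefficients have dropped out, and the
      horizontal ones have become the constants \<open>C\<close>.\<close>
    have nabla: "cartan_nabla A F u X Y' c = (0, \<chi> k. dird (X c) (\<lambda>w. snd (Y' (param A c w) c) $ k) w
        + (\<Sum>l\<in>UNIV. (\<Sum>j\<in>UNIV. snd (Y' u c) $ j * C k j l) * a $ l))" for Y'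
      unfolding cartan_nabla_def if_P[OF True] Let_def L_def[symmetric] w_def[symmetric]
        a_def[symmetric] v h sum_distrib_right
      by (subst sum.swap) (simp add: mult_ac)
    have "(\<lambda>w. Y (param A c w) c) differentiable (at w)"
      using Y c u' unfolding vertical_section_def w_def
      by (blast intro: smooth_on_differentiable)
    then have f: "f differentiable (at w)"
      unfolding f_def by (rule dird_bounded_linear(2)[OF bounded_linear_snd])
    \<comment> \<open>Both terms commute with the complex structure: the derivative because \<open>J_coord\<close> is a constant
      linear map, the connection term by \<open>real_coeff_J\<close>.\<close>
    show ?thesis
      unfolding nabla J_vec_def fst_conv snd_conv J_coord_0 prod.inject vec_eq_iff
      using dird_J_coord[OF f, unfolded f_def]
      by (simp add: real_coeff_J J_coord_sum_nth J_coord_add_nth)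
  qed
qed

end
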